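(* Let $\mathbb{P}$ and $\mathbb{Q}$ be two distributions (of a single observation) that are mutually absolutely continuous, and assume that the distribution of $\log\frac{d\mathbb{Q}}{d\mathbb{P}}$ is atomless. Let $X_1,X_2,\dots$ be i.i.d. observations and let $\mathrm{LR}_n=\prod_{i=1}^n\frac{d\mathbb{Q}}{d\mathbb{P}}(X_i)$. Set $\alpha_N=\exp\{-N\,D(\mathbb{Q}\|\mathbb{P})\}$, where $D(\cdot\|\cdot)$ denotes the Kullback–Leibler divergence. Let $\phi_{N,\alpha_N}$ denote the level $\alpha_N$ Neyman–Pearson test of $\mathbb{P}$ against $\mathbb{Q}$ based on the $N$ i.i.d. observations $X_1,\dots,X_N$, and let $\phi'_{n,\alpha_N}=\mathbb{E}^{\mathbb{P}}[\phi_{N,\alpha_N}\mid X_1,\dots,X_n]$ denote its conditional expectation under $\mathbb{P}$ given the first $n$ observations. Assume that there exists an $\epsilon>0$ such that the $(1+\epsilon)$-order Rényi divergence $D_{1+\epsilon}(\mathbb{Q}\|\mathbb{P})$ is finite, and that $\log\mathrm{LR}_1$ is not lattice-valued under $\mathbb{P}$. Then $$\lim_{N\to\infty}\frac{\phi'_{n,\alpha_N}}{\alpha_N}=\mathrm{LR}_n,\qquad\mathbb{P}\text{-a.s., for all }n\in\mathbb{N}.$$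
   Context: "$\mathbb{P}$-a.s." and $\mathbb{E}^{\mathbb{P}}$ refer to the law under which $X_1,X_2,\dots$ are i.i.d. with distribution $\mathbb{P}$. The level $\alpha_N$ Neyman–Pearson test is $\phi_{N,\alpha_N}=\mathbb{I}\{\log\mathrm{LR}_N\ge t_N\}$ with threshold $t_N$ such that $\mathbb{P}(\log\mathrm{LR}_N\ge t_N)=\alpha_N$ (no randomization is needed by the atomless assumption). The Rényi divergence of order $1+\epsilon$ is $D_{1+\epsilon}(\mathbb{Q}\|\mathbb{P})=\frac1\epsilon\log\mathbb{E}^{\mathbb{P}}\bigl[(d\mathbb{Q}/d\mathbb{P})^{1+\epsilon}\bigr]$. A random variable is lattice-valued if it takes values almost surely in a set $\{a+kh:k\in\mathbb{Z}\}$ for some $a\in\mathbb{R}$, $h>0$. *)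

theory Defs
  imports "HOL-Probability.Probability"
begin

(* Argument order in all definitions follows KL_divergence and RN_deriv: the base measure P comes
   first, so RN_deriv P Q is dQ/dP and KL_divergence (exp 1) P Q is D(Q || P) in nats. *)

definition log_density_ratio :: "'a measure \<Rightarrow> 'a measure \<Rightarrow> 'a \<Rightarrow> real" where
  "log_density_ratio P Q x = ln (enn2real (RN_deriv P Q x))"

(* D_a(Q || P) = 1/(a-1) * log E^P[(dQ/dP)^a] for orders a > 1, extended-real valued,
   with log 0 = -\<infinity> and log \<infinity> = \<infinity>. *)
definition renyi_divergence :: "real \<Rightarrow> 'a measure \<Rightarrow> 'a measure \<Rightarrow> ereal" where
  "renyi_divergence a P Q =
     (let I = (\<integral>\<^sup>+ x. ennreal (enn2real (RN_deriv P Q x) powr a) \<partial>P)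
      in if I = \<infinity> then \<infinity>
         else if I = 0 then - \<infinity>
         else ereal (1 / (a - 1) * ln (enn2real I)))"

(* For a Borel measure on the real line, having no atoms is the same as having no point masses. *)
definition atomless :: "real measure \<Rightarrow> bool" where
  "atomless \<mu> \<longleftrightarrow> (\<forall>c. emeasure \<mu> {c} = 0)"

definition lattice_valued :: "'w measure \<Rightarrow> ('w \<Rightarrow> real) \<Rightarrow> bool" where
  "lattice_valued \<Omega> Y \<longleftrightarrow>
     (\<exists>a h. h > 0 \<and> (AE \<omega> in \<Omega>. Y \<omega> \<in> {a + of_int k * h | k :: int. True}))"

(* Observations are indexed from 0: the first n observations are X 0, ..., X (n - 1). *)
definition LR :: "'a measure \<Rightarrow> 'a measure \<Rightarrow> (nat \<Rightarrow> 'w \<Rightarrow> 'a) \<Rightarrow> nat \<Rightarrow> 'w \<Rightarrow> real" where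
  "LR P Q X n \<omega> = (\<Prod>i<n. enn2real (RN_deriv P Q (X i \<omega>)))"

definition iid :: "'w measure \<Rightarrow> 'a measure \<Rightarrow> (nat \<Rightarrow> 'w \<Rightarrow> 'a) \<Rightarrow> bool" where
  "iid \<Omega> P X \<longleftrightarrow>
     prob_space.indep_vars \<Omega> (\<lambda>_. P) X UNIV \<and> (\<forall>i. distr \<Omega> P (X i) = P)"

definition obs_algebra :: "'w measure \<Rightarrow> 'a measure \<Rightarrow> (nat \<Rightarrow> 'w \<Rightarrow> 'a) \<Rightarrow> nat \<Rightarrow> 'w measure" where
  "obs_algebra \<Omega> P X n =
     vimage_algebra (space \<Omega>) (\<lambda>\<omega>. \<lambda>i\<in>{..<n}. X i \<omega>) (Pi\<^sub>M {..<n} (\<lambda>_. P))"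

definition np_threshold ::
  "'w measure \<Rightarrow> 'a measure \<Rightarrow> 'a measure \<Rightarrow> (nat \<Rightarrow> 'w \<Rightarrow> 'a) \<Rightarrow> nat \<Rightarrow> real \<Rightarrow> real \<Rightarrow> bool" where
  "np_threshold \<Omega> P Q X N \<alpha> t \<longleftrightarrow> measure \<Omega> {\<omega> \<in> space \<Omega>. t \<le> ln (LR P Q X N \<omega>)} = \<alpha>"

definition np_test ::
  "'a measure \<Rightarrow> 'a measure \<Rightarrow> (nat \<Rightarrow> 'w \<Rightarrow> 'a) \<Rightarrow> nat \<Rightarrow> real \<Rightarrow> 'w \<Rightarrow> real" where
  "np_test P Q X N t \<omega> = (if t \<le> ln (LR P Q X N \<omega>) then 1 else 0)"

end

theory Submission
  imports Defs "HOL-Real_Asymp.Real_Asymp"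
begin

text \<open>
  Write \<open>L\<close> for \<open>log dQ/dP\<close>, \<open>S\<^sub>N\<close> for the sum of the \<open>L(X\<^sub>i)\<close> over the first \<open>N\<close> observations, and \<open>m\<close> for
  the Kullback--Leibler divergence, which is the mean of \<open>L\<close> under \<open>Q\<close>. Conditioning on the first \<open>n\<close>
  observations leaves a fresh sum of \<open>N - n\<close> terms, so the conditional expectation of the test is
  \<open>W\<^sub>N\<^sub>-\<^sub>n(t\<^sub>N - S\<^sub>n)\<close> with \<open>W\<^sub>N(s) = P(S\<^sub>N \<ge> s)\<close>, while \<open>\<alpha>\<^sub>N = W\<^sub>N(t\<^sub>N)\<close>. The theorem says that removing \<open>n\<close>
  summands and moving the threshold by \<open>s\<close> multiplies the tail by \<open>exp s\<close> in the limit.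

  This follows from the exact asymptotics \<open>W\<^sub>N(T\<^sub>N) \<sim> c exp(-T\<^sub>N) / sqrt N\<close>, valid for every sequence with
  \<open>T\<^sub>N - N m = o(sqrt N)\<close> (lemma \<open>exact_tail_asymptotics\<close>, an instance of the Bahadur--Rao theorem whose
  tilting parameter is \<open>1\<close>). The choice \<open>\<alpha>\<^sub>N = exp(-N m)\<close> traps \<open>t\<^sub>N\<close> between \<open>N m - ln N\<close> and \<open>N m\<close>, so that both the
  numerator and the denominator of the ratio are in this range (lemma \<open>tail_ratio_tendsto\<close>).

  To prove the asymptotics, tilt by \<open>exp L\<close>, that is, pass from \<open>P\<close> to \<open>Q\<close>. The tilted sum is centred at
  \<open>N m\<close>, has finite variance because of the Renyi condition, and is non-lattice. The function
  \<open>F\<^sub>N(s) = exp s W\<^sub>N(s)\<close> is precisely the probability density of \<open>S\<^sub>N - E\<close> under \<open>Q\<close>, where \<open>E\<close> is an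
  independent standard exponential variable (lemma \<open>tilted_convolution_neg_exponential\<close>). Averages of
  \<open>F\<^sub>N\<close> against a Fejer kernel are therefore integrals of the characteristic function over a bounded
  range of frequencies. After scaling by \<open>sqrt N\<close> they converge to a Gaussian integral by dominated
  convergence: near frequency zero the variance gives Gaussian decay, and away from zero the
  non-lattice condition gives exponential decay in \<open>N\<close>. Finally the averages are removed by a Tauberian
  argument (lemma \<open>smoothing_tauberian\<close>): since \<open>W\<^sub>N\<close> is decreasing, \<open>F\<^sub>N(s') \<le> exp(s' - s) F\<^sub>N(s)\<close> for
  \<open>s \<le> s'\<close>, and such a function cannot differ much from its averages over short windows placed
  just to its left and just to its right.
\<close>
section \<open>The Fejer kernel\<close>

definition tent :: "real \<Rightarrow> real" where
  "tent u = max 0 (1 - \<bar>u\<bar>)"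

text \<open>
  This is \<open>2 (1 - cos y) / y\<^sup>2\<close>, the unnormalised Fejer kernel. Defining it as a cosine transform
  makes its compactly supported Fourier transform available without an inversion theorem, and
  gives the right value at \<open>y = 0\<close>.
\<close>
definition fejer :: "real \<Rightarrow> real" where
  "fejer y = (LINT u|lborel. tent u * cos (u * y))"

lemma tent_measurable [measurable]: "tent \<in> borel_measurable borel"
  unfolding tent_def by measurable

lemma tent_bounds: "0 \<le> tent u" "tent u \<le> indicator {-1..1} u"
  by (auto simp: tent_def indicator_def)

lemma integrable_tent: "integrable lborel tent"
proof (rule Bochner_Integration.integrable_bound)
  show "integrable lborel (indicator {-1..1::real} :: real \<Rightarrow> real)"
    by (simp add: integrable_indicator_iff)
  show "AE u in lborel. norm (tent u) \<le> norm (indicator {-1..1} u :: real)"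
    using tent_bounds by (intro AE_I2) (simp add: order_trans[OF tent_bounds(2)])
qed simp

lemma fejer_measurable [measurable]: "fejer \<in> borel_measurable borel"
  unfolding fejer_def[abs_def] by measurable

lemma fejer_eq:
  assumes "y \<noteq> 0"
  shows "fejer y = 2 * (1 - cos y) / y\<^sup>2"
proof -
  have R: "has_bochner_integral lborel (\<lambda>u. indicator {0..1} u *\<^sub>R ((1 - u) * cos (u * y)))
      (((1 - 1) * sin (1 * y) / y - cos (1 * y) / y\<^sup>2) - ((1 - 0) * sin (0 * y) / y - cos (0 * y) / y\<^sup>2))"
    using assms
    by (intro has_bochner_integral_FTC_Icc)
       (auto intro!: derivative_eq_intros continuous_intros
         simp: has_real_derivative_iff_has_vector_derivative[symmetric] field_simps power2_eq_square)
  have L: "has_bochner_integral lborel (\<lambda>u. indicator {-1..0} u *\<^sub>R ((1 + u) * cos (u * y)))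
      (((1 + 0) * sin (0 * y) / y + cos (0 * y) / y\<^sup>2) - ((1 + (-1)) * sin (-1 * y) / y + cos (-1 * y) / y\<^sup>2))"
    using assms
    by (intro has_bochner_integral_FTC_Icc)
       (auto intro!: derivative_eq_intros continuous_intros
         simp: has_real_derivative_iff_has_vector_derivative[symmetric] field_simps power2_eq_square)
  have "AE u in lborel. u \<noteq> (0::real)"
    by (rule AE_lborel_singleton)
  then have "fejer y = (LINT u|lborel. indicator {0..1} u *\<^sub>R ((1 - u) * cos (u * y))
      + indicator {-1..0} u *\<^sub>R ((1 + u) * cos (u * y)))"
    unfolding fejer_def
    by (intro integral_cong_AE) (auto elim!: eventually_mono simp: tent_def indicator_def)
  also have "\<dots> = 2 * (1 - cos y) / y\<^sup>2"
    unfolding has_bochner_integral_integral_eq[OF has_bochner_integral_add[OF R L]]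
    by (simp add: diff_divide_distrib)
  finally show ?thesis .
qed

lemma fejer_nonneg: "0 \<le> fejer y"
proof (cases "y = 0")
  case True
  then show ?thesis
    by (simp add: fejer_def tent_bounds)
next
  case False
  then show ?thesis
    by (simp add: fejer_eq)
qed

lemma fejer_le_2: "fejer y \<le> 2"
proof -
  have "fejer y \<le> (LINT u|lborel. indicator {-1..1::real} u)"
    unfolding fejer_def
  proof (rule integral_mono)
    show "integrable lborel (\<lambda>u. tent u * cos (u * y))"
      by (rule Bochner_Integration.integrable_bound[OF integrable_tent])
         (auto simp: abs_mult mult_left_le)
    show "integrable lborel (indicator {-1..1::real} :: real \<Rightarrow> real)"
      by (simp add: integrable_indicator_iff)
    fix u :: real
    have "tent u * cos (u * y) \<le> tent u * 1"
      by (intro mult_left_mono) (auto simp: tent_bounds)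
    then show "tent u * cos (u * y) \<le> indicator {-1..1} u"
      using tent_bounds(2)[of u] by simp
  qed
  also have "\<dots> = 2"
    by simp
  finally show ?thesis by simp
qed

lemma integrable_fejer: "integrable lborel fejer"
proof (rule Bochner_Integration.integrable_bound)
  show "integrable lborel (\<lambda>y::real. 6 * inverse (1 + y\<^sup>2))"
    using integrable_inverse_1_plus_square by (simp add: set_integrable_def)
  have "\<bar>fejer y\<bar> \<le> 6 * inverse (1 + y\<^sup>2)" for y
  proof -
    have "y\<^sup>2 * fejer y \<le> 4"
      using cos_ge_minus_one[of y] by (cases "y = 0") (auto simp: fejer_eq simp del: cos_ge_minus_one)
    then have "(1 + y\<^sup>2) * fejer y \<le> 6"
      using fejer_le_2[of y] by (simp add: algebra_simps)
    moreover have "0 < 1 + y\<^sup>2"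
      by (simp add: add_pos_nonneg)
    ultimately show ?thesis
      using fejer_nonneg[of y] by (simp add: divide_inverse[symmetric] pos_le_divide_eq mult.commute)
  qed
  then show "AE y in lborel. norm (fejer y) \<le> norm (6 * inverse (1 + y\<^sup>2))"
    by (intro AE_I2) (metis abs_ge_self order_trans real_norm_def)
qed simp

lemma fejer_integral_pos: "0 < (LINT y|lborel. fejer y)"
proof (rule ccontr)
  assume "\<not> ?thesis"
  moreover have "0 \<le> (LINT y|lborel. fejer y)"
    by (simp add: fejer_nonneg)
  ultimately have "(LINT y|lborel. fejer y) = 0"
    by simp
  then have "AE y in lborel. fejer y = 0"
    by (subst (asm) integral_nonneg_eq_0_iff_AE) (auto simp: integrable_fejer fejer_nonneg)
  moreover have "fejer y \<noteq> 0" if "y \<in> {1..2}" for y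
  proof -
    have "cos y < cos 0"
      using that pi_gt3 by (intro cos_monotone_0_pi) auto
    then show ?thesis
      using that by (simp add: fejer_eq)
  qed
  ultimately have "AE y in lborel. y \<notin> {1..2::real}"
    by (auto elim!: eventually_mono)
  then have "emeasure lborel {1..2::real} = 0"
    by (subst (asm) AE_iff_measurable[where N="{1..2}"]) auto
  then show False by simp
qed

section \<open>A one-sided Tauberian lemma for convolution averages\<close>

text \<open>
  The average \<open>J k N T\<close> replaces the kernel \<open>K\<close> by its rescaling by \<open>k\<^sup>2\<close>. Then almost all of the mass of
  \<open>K\<close> sits in a window of width \<open>2 / k\<close>, because \<open>k\<^sup>2 (1 / k) = k\<close> tends to infinity, and on such a window
  the growth condition costs only a factor \<open>exp (2 / k)\<close>. Placing the window to the left of \<open>T\<close> bounds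
  \<open>p N T\<close> from above by an average; this also bounds \<open>p\<close> uniformly, which controls the mass of \<open>K\<close>
  outside the window when the window is placed to the right and the bound is from below. The
  predicate \<open>R\<close> is the class of centring sequences, which has to be stable under these shifts.
\<close>
lemma smoothing_tauberian:
  fixes K :: "real \<Rightarrow> real" and p :: "nat \<Rightarrow> real \<Rightarrow> real" and R :: "(nat \<Rightarrow> real) \<Rightarrow> bool"
  defines "J \<equiv> \<lambda>k N T. LINT x|lborel. K x * p N (T - x / (real k)\<^sup>2)"
  assumes K [measurable]: "integrable lborel K" and K_nonneg: "\<And>x. 0 \<le> K x"
    and mass: "0 < (LINT x|lborel. K x)"
    and p_nonneg: "\<And>N s. 0 \<le> p N s"
    and growth: "\<And>N s s'. s \<le> s' \<Longrightarrow> p N s' \<le> exp (s' - s) * p N s"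
    and int: "\<And>k N T. k > 0 \<Longrightarrow> integrable lborel (\<lambda>x. K x * p N (T - x / (real k)\<^sup>2))"
    and bounded: "\<And>k. k > 0 \<Longrightarrow> \<exists>B. \<forall>N>0. \<forall>T. J k N T \<le> B"
    and shift: "\<And>T d. R T \<Longrightarrow> R (\<lambda>N. T N + d)"
    and limit: "\<And>k T. k > 0 \<Longrightarrow> R T \<Longrightarrow> (\<lambda>N. J k N (T N)) \<longlonglongrightarrow> G"
    and T: "R T"
  shows "(\<lambda>N. p N (T N)) \<longlonglongrightarrow> G / (LINT x|lborel. K x)"
proof -
  define M where "M = (LINT x|lborel. K x)"
  define m where "m k = (LINT x|lborel. indicator {- real k..real k} x * K x)" for k
  have int_m: "integrable lborel (\<lambda>x. indicator {- real k..real k} x * K x)" for k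
    using integrable_mult_indicator[OF _ K, of "{- real k..real k}"] by simp
  have m_le: "m k \<le> M" for k
    unfolding m_def M_def using K int_m K_nonneg
    by (intro integral_mono) (auto simp: indicator_def)
  have m_lim: "m \<longlonglongrightarrow> M"
    unfolding m_def[abs_def] M_def
  proof (rule integral_dominated_convergence[where w = K])
    show "AE x in lborel. (\<lambda>k. indicator {- real k..real k} x * K x) \<longlonglongrightarrow> K x"
    proof (intro AE_I2)
      fix x :: real
      obtain k0 :: nat where k0: "\<bar>x\<bar> \<le> real k0"
        using real_arch_simple by blast
      have "\<forall>\<^sub>F k in sequentially. indicator {- real k..real k} x * K x = K x"
        using eventually_ge_at_top[of k0]
      proof eventually_elim
        case (elim k)
        then have "\<bar>x\<bar> \<le> real k" using k0 by linarith
        then show ?case by (auto simp: indicator_def)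
      qed
      then show "(\<lambda>k. indicator {- real k..real k} x * K x) \<longlonglongrightarrow> K x"
        by (rule tendsto_eventually)
    qed
  qed (use K in \<open>auto simp: indicator_def K_nonneg\<close>)
  have window: "\<bar>x / (real k)\<^sup>2\<bar> \<le> 1 / real k" if "x \<in> {- real k..real k}" "k > 0" for x k
    using that by (auto simp: field_simps power2_eq_square abs_le_iff)

  have two: "2 / real k = 1 / real k + 1 / real k" for k
    by simp
  have upper: "p N s * m k \<le> exp (2 / real k) * J k N (s - 1 / real k)" if k: "k > 0" for k N s
  proof -
    have "p N s * m k = (LINT x|lborel. p N s * (indicator {- real k..real k} x * K x))"
      by (simp add: m_def)
    also have "\<dots> \<le> (LINT x|lborel. exp (2 / real k) * (K x * p N (s - 1 / real k - x / (real k)\<^sup>2)))"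
    proof (rule integral_mono)
      fix x
      show "p N s * (indicator {- real k..real k} x * K x)
        \<le> exp (2 / real k) * (K x * p N (s - 1 / real k - x / (real k)\<^sup>2))"
      proof (cases "x \<in> {- real k..real k}")
        case True
        let ?y = "x / (real k)\<^sup>2"
        have y: "\<bar>?y\<bar> \<le> 1 / real k" by (rule window[OF True k])
        have "p N s \<le> exp (s - (s - 1 / real k - ?y)) * p N (s - 1 / real k - ?y)"
          using y by (intro growth) linarith
        moreover have "s - (s - 1 / real k - ?y) \<le> 2 / real k"
          using y two[of k] by linarith
        then have "exp (s - (s - 1 / real k - ?y)) * p N (s - 1 / real k - ?y)
            \<le> exp (2 / real k) * p N (s - 1 / real k - ?y)"
          by (intro mult_right_mono p_nonneg) (simp only: exp_le_cancel_iff)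
        ultimately have "p N s \<le> exp (2 / real k) * p N (s - 1 / real k - ?y)"
          by (rule order_trans)
        then have "p N s * K x \<le> exp (2 / real k) * p N (s - 1 / real k - ?y) * K x"
          by (rule mult_right_mono[OF _ K_nonneg])
        then show ?thesis using True by (simp add: mult_ac)
      qed (simp add: K_nonneg p_nonneg)
    qed (use int_m int[OF k] in auto)
    also have "\<dots> = exp (2 / real k) * J k N (s - 1 / real k)"
      by (simp add: J_def)
    finally show ?thesis .
  qed

  obtain k0 where k0: "k0 > 0" "0 < m k0"
  proof -
    have "\<forall>\<^sub>F k in sequentially. 0 < m k"
      using m_lim mass by (intro order_tendstoD(1)) (auto simp: M_def)
    then obtain k1 where "\<forall>k\<ge>k1. 0 < m k"
      by (auto simp: eventually_sequentially)
    then show thesis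
      by (intro that[of "max 1 k1"]) auto
  qed
  obtain B where B: "\<And>N s. N > 0 \<Longrightarrow> J k0 N s \<le> B"
    using bounded[OF k0(1)] by blast
  define C where "C = exp (2 / real k0) * B / m k0"
  have C: "p N s \<le> C" if "N > 0" for N s
  proof -
    have "p N s * m k0 \<le> exp (2 / real k0) * B"
      using upper[OF k0(1), of N s] B[OF that, of "s - 1 / real k0"]
      by (meson exp_ge_zero mult_left_mono order_trans)
    then show ?thesis
      using k0(2) by (simp add: C_def pos_le_divide_eq)
  qed

  have lower: "J k N (s + 1 / real k) \<le> exp (2 / real k) * (p N s * m k) + C * (M - m k)"
    if k: "k > 0" and N: "N > 0" for k N s
  proof -
    have "J k N (s + 1 / real k) \<le> (LINT x|lborel.
        exp (2 / real k) * p N s * (indicator {- real k..real k} x * K x)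
        + C * (K x - indicator {- real k..real k} x * K x))"
      unfolding J_def
    proof (rule integral_mono)
      fix x
      let ?y = "x / (real k)\<^sup>2"
      show "K x * p N (s + 1 / real k - ?y) \<le>
        exp (2 / real k) * p N s * (indicator {- real k..real k} x * K x)
        + C * (K x - indicator {- real k..real k} x * K x)"
      proof (cases "x \<in> {- real k..real k}")
        case True
        have y: "\<bar>?y\<bar> \<le> 1 / real k" by (rule window[OF True k])
        have "p N (s + 1 / real k - ?y) \<le> exp (s + 1 / real k - ?y - s) * p N s"
          using y by (intro growth) linarith
        moreover have "s + 1 / real k - ?y - s \<le> 2 / real k"
          using y two[of k] by linarith
        then have "exp (s + 1 / real k - ?y - s) * p N s \<le> exp (2 / real k) * p N s"
          by (intro mult_right_mono p_nonneg) (simp only: exp_le_cancel_iff)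
        ultimately have "p N (s + 1 / real k - ?y) \<le> exp (2 / real k) * p N s"
          by (rule order_trans)
        then have "K x * p N (s + 1 / real k - ?y) \<le> K x * (exp (2 / real k) * p N s)"
          by (rule mult_left_mono[OF _ K_nonneg])
        then show ?thesis using True by (simp add: mult_ac)
      next
        case False
        have "K x * p N (s + 1 / real k - ?y) \<le> K x * C"
          by (intro mult_left_mono C N K_nonneg)
        then show ?thesis using False by (simp add: mult_ac)
      qed
    qed (use int_m int[OF k] K in auto)
    also have "\<dots> = exp (2 / real k) * p N s * m k + C * (M - m k)"
      using int_m K by (simp add: m_def M_def)
    finally show ?thesis by (simp add: mult_ac)
  qed

  have exp_lim: "(\<lambda>k. exp (2 / real k)) \<longlonglongrightarrow> 1"
    using tendsto_exp[OF lim_const_over_n[of 2]] by simp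
  have M: "0 < M" using mass by (simp add: M_def)
  have m_pos: "\<forall>\<^sub>F k in sequentially. 0 < m k"
    using m_lim M by (rule order_tendstoD(1))
  have "(\<lambda>N. p N (T N)) \<longlonglongrightarrow> G / M"
  proof (rule order_tendstoI)
    fix c assume c: "G / M < c"
    have "(\<lambda>k. exp (2 / real k) * G / m k) \<longlonglongrightarrow> 1 * G / M"
      using M by (intro tendsto_intros exp_lim m_lim) auto
    then have "\<forall>\<^sub>F k in sequentially. exp (2 / real k) * G / m k < c"
      using c by (intro order_tendstoD(2)) auto
    then have "\<forall>\<^sub>F k in sequentially. exp (2 / real k) * G / m k < c \<and> 0 < m k \<and> 0 < k"
      by (intro eventually_conj m_pos eventually_gt_at_top)
    then obtain k where k: "exp (2 / real k) * G / m k < c" "0 < m k" "k > 0"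
      by (blast dest: eventually_happens'[OF sequentially_bot])
    have "(\<lambda>N. exp (2 / real k) * J k N (T N + - (1 / real k)) / m k) \<longlonglongrightarrow> exp (2 / real k) * G / m k"
      using k by (intro tendsto_intros limit shift T) auto
    then have "\<forall>\<^sub>F N in sequentially. exp (2 / real k) * J k N (T N + - (1 / real k)) / m k < c"
      using k(1) by (rule order_tendstoD(2))
    then show "\<forall>\<^sub>F N in sequentially. p N (T N) < c"
    proof eventually_elim
      case (elim N)
      have "p N (T N) \<le> exp (2 / real k) * J k N (T N + - (1 / real k)) / m k"
        using upper[OF k(3), of N "T N"] k(2) by (simp add: pos_le_divide_eq)
      with elim show ?case by simp
    qed
  next
    fix c assume c: "c < G / M"
    have "(\<lambda>k. (G - C * (M - m k)) / (exp (2 / real k) * m k)) \<longlonglongrightarrow> (G - C * (M - M)) / (1 * M)"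
      using M by (intro tendsto_intros exp_lim m_lim) auto
    then have "\<forall>\<^sub>F k in sequentially. c < (G - C * (M - m k)) / (exp (2 / real k) * m k)"
      using c by (intro order_tendstoD(1)) auto
    then have "\<forall>\<^sub>F k in sequentially. c < (G - C * (M - m k)) / (exp (2 / real k) * m k) \<and> 0 < m k \<and> 0 < k"
      by (intro eventually_conj m_pos eventually_gt_at_top)
    then obtain k where k: "c < (G - C * (M - m k)) / (exp (2 / real k) * m k)" "0 < m k" "k > 0"
      by (blast dest: eventually_happens'[OF sequentially_bot])
    have "(\<lambda>N. (J k N (T N + 1 / real k) - C * (M - m k)) / (exp (2 / real k) * m k))
        \<longlonglongrightarrow> (G - C * (M - m k)) / (exp (2 / real k) * m k)"
      using k by (intro tendsto_intros limit shift T) auto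
    then have "\<forall>\<^sub>F N in sequentially.
        c < (J k N (T N + 1 / real k) - C * (M - m k)) / (exp (2 / real k) * m k)"
      using k(1) by (rule order_tendstoD(1))
    then show "\<forall>\<^sub>F N in sequentially. c < p N (T N)"
      using eventually_gt_at_top[of 0]
    proof eventually_elim
      case (elim N)
      have "(J k N (T N + 1 / real k) - C * (M - m k)) / (exp (2 / real k) * m k) \<le> p N (T N)"
        using lower[OF k(3) elim(2), of "T N"] k(2) by (simp add: pos_divide_le_eq mult_ac)
      with elim show ?case by simp
    qed
  qed
  then show ?thesis by (simp add: M_def)
qed

section \<open>Characteristic functions of centred non-lattice laws\<close>

text \<open>
  The remainder of the second-order expansion is at most \<open>t\<^sup>2\<close> times a truncated third moment, which vanishes as \<open>t\<close> tends to \<open>0\<close> by dominated convergence although no third moment is assumed.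
\<close>
lemma (in real_distribution) char_second_order:
  assumes "integrable M (\<lambda>x. x)" "expectation (\<lambda>x. x) = 0" "integrable M (\<lambda>x. x\<^sup>2)"
    and var: "variance (\<lambda>x. x) = v"
  shows "((\<lambda>t. (char M t - complex_of_real (1 - t\<^sup>2 * v / 2)) / complex_of_real (t\<^sup>2)) \<longlongrightarrow> 0) (at 0)"
proof (rule Lim_null_comparison)
  let ?g = "\<lambda>t. expectation (\<lambda>x. min (6 * x\<^sup>2) (\<bar>t\<bar> * \<bar>x\<bar> ^ 3))"
  have "norm ((char M t - complex_of_real (1 - t\<^sup>2 * v / 2)) / complex_of_real (t\<^sup>2)) \<le> ?g t / 6"
    if "t \<noteq> 0" for t
    using char_approx3[OF assms, of t] that
    by (simp add: norm_divide norm_power divide_le_eq mult_ac)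
  then show "\<forall>\<^sub>F t in at 0. norm ((char M t - complex_of_real (1 - t\<^sup>2 * v / 2)) / complex_of_real (t\<^sup>2)) \<le> ?g t / 6"
    by (auto simp: eventually_at_filter)
  have "?g \<midarrow>0\<rightarrow> expectation (\<lambda>x. 0)"
    unfolding tendsto_at_iff_sequentially comp_def
  proof (intro allI impI)
    fix X :: "nat \<Rightarrow> real" assume X: "X \<longlonglongrightarrow> 0"
    show "(\<lambda>i. ?g (X i)) \<longlonglongrightarrow> expectation (\<lambda>x. 0)"
    proof (rule integral_dominated_convergence[where w = "\<lambda>x. 6 * x\<^sup>2"])
      show "AE x in M. (\<lambda>i. min (6 * x\<^sup>2) (\<bar>X i\<bar> * \<bar>x\<bar> ^ 3)) \<longlonglongrightarrow> 0"
      proof (intro AE_I2)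
        fix x :: real
        have "(\<lambda>i. min (6 * x\<^sup>2) (\<bar>X i\<bar> * \<bar>x\<bar> ^ 3)) \<longlonglongrightarrow> min (6 * x\<^sup>2) (\<bar>0\<bar> * \<bar>x\<bar> ^ 3)"
          by (intro tendsto_intros X)
        then show "(\<lambda>i. min (6 * x\<^sup>2) (\<bar>X i\<bar> * \<bar>x\<bar> ^ 3)) \<longlonglongrightarrow> 0" by simp
      qed
      show "integrable M (\<lambda>x. 6 * x\<^sup>2)"
        using assms(3) by simp
      show "AE x in M. norm (min (6 * x\<^sup>2) (\<bar>X i\<bar> * \<bar>x\<bar> ^ 3)) \<le> 6 * x\<^sup>2" for i
        by (intro AE_I2) (simp add: min_def)
    qed measurable
  qed
  then show "((\<lambda>t. ?g t / 6) \<longlongrightarrow> 0) (at 0)"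
    using tendsto_divide[OF _ tendsto_const, of ?g 0 "at 0" 6] by simp
qed

text \<open>
  One Gaussian bound serves a whole compact range of frequencies: near \<open>0\<close> it comes from the second
  order expansion, and on the remaining compact set from the maximum of the modulus being below \<open>1\<close>.
  Its \<open>N\<close>-th power, evaluated at \<open>u / sqrt N\<close>, is a dominating function independent of \<open>N\<close>.
\<close>
lemma (in real_distribution) char_gaussian_bound:
  assumes m: "integrable M (\<lambda>x. x)" "expectation (\<lambda>x. x) = 0" "integrable M (\<lambda>x. x\<^sup>2)"
    and var: "variance (\<lambda>x. x) = v" and v: "v > 0"
    and strict: "\<And>u. u \<noteq> 0 \<Longrightarrow> norm (char M u) < 1"
  obtains c where "c > 0" "\<And>u. \<bar>u\<bar> \<le> A \<Longrightarrow> norm (char M u) \<le> exp (- c * u\<^sup>2)"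
proof -
  have "\<forall>\<^sub>F t in at 0. dist ((char M t - complex_of_real (1 - t\<^sup>2 * v / 2)) / complex_of_real (t\<^sup>2)) 0 < v / 4"
    using v by (intro tendstoD[OF char_second_order[OF m var]]) simp
  then obtain d where d: "d > 0" and
    near: "\<And>t. t \<noteq> 0 \<Longrightarrow> \<bar>t\<bar> < d \<Longrightarrow> norm ((char M t - complex_of_real (1 - t\<^sup>2 * v / 2)) / complex_of_real (t\<^sup>2)) < v / 4"
    unfolding eventually_at by (auto simp: dist_real_def)
  \<comment> \<open>below \<open>1 / sqrt v\<close> the quadratic \<open>1 - u\<^sup>2 v / 2\<close> is non-negative and equals its modulus\<close>
  define e where "e = min d (1 / sqrt v)"
  have e: "e > 0" using d v by (simp add: e_def)
  have small: "norm (char M u) \<le> exp (- (v / 4) * u\<^sup>2)" if u: "\<bar>u\<bar> < e" for u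
  proof (cases "u = 0")
    case False
    then have u2: "0 < u\<^sup>2" by simp
    have "u\<^sup>2 \<le> (1 / sqrt v)\<^sup>2"
      using u by (intro abs_le_square_iff[THEN iffD1]) (use v in \<open>auto simp: e_def\<close>)
    then have "u\<^sup>2 * v \<le> 1"
      using v by (simp add: power_divide field_simps)
    then have nn: "0 \<le> 1 - u\<^sup>2 * v / 2" by simp
    have "norm (char M u - complex_of_real (1 - u\<^sup>2 * v / 2)) \<le> v / 4 * u\<^sup>2"
      using near[of u] False u u2 by (simp add: norm_divide norm_power divide_less_eq e_def)
    then have "norm (char M u) \<le> (1 - u\<^sup>2 * v / 2) + v / 4 * u\<^sup>2"
      using norm_triangle_sub[of "char M u" "complex_of_real (1 - u\<^sup>2 * v / 2)"] nn
      by (simp only: norm_of_real abs_of_nonneg)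
    also have "\<dots> = 1 + (- (v / 4) * u\<^sup>2)" by (simp add: field_simps)
    also have "\<dots> \<le> exp (- (v / 4) * u\<^sup>2)" by (rule exp_ge_add_one_self)
    finally show ?thesis .
  qed (simp add: char_zero)
  have "\<exists>c>0. \<forall>u\<in>{u. e \<le> \<bar>u\<bar> \<and> \<bar>u\<bar> \<le> A}. norm (char M u) \<le> exp (- c * u\<^sup>2)"
  proof (cases "{u. e \<le> \<bar>u\<bar> \<and> \<bar>u\<bar> \<le> A} = {}")
    case True
    then show ?thesis by (intro exI[of _ 1]) auto
  next
    case False
    have comp: "compact {u::real. e \<le> \<bar>u\<bar> \<and> \<bar>u\<bar> \<le> A}"
      unfolding compact_eq_bounded_closed
      by (intro conjI boundedI[of _ A] closed_Collect_conj closed_Collect_le continuous_intros) auto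
    have "continuous_on {u::real. e \<le> \<bar>u\<bar> \<and> \<bar>u\<bar> \<le> A} (\<lambda>u. norm (char M u))"
      by (intro continuous_intros continuous_at_imp_continuous_on ballI isCont_char)
    from continuous_attains_sup[OF comp False this] obtain w where
      w: "e \<le> \<bar>w\<bar>" "\<And>u. e \<le> \<bar>u\<bar> \<Longrightarrow> \<bar>u\<bar> \<le> A \<Longrightarrow> norm (char M u) \<le> norm (char M w)"
      by auto
    \<comment> \<open>\<open>1 / 2\<close> keeps the logarithm finite if the characteristic function vanishes there\<close>
    define r where "r = max (norm (char M w)) (1 / 2)"
    have r: "0 < r" "r < 1" using strict[of w] w(1) e by (auto simp: r_def)
    define c where "c = - ln r / A\<^sup>2"
    have A: "A > 0" using False e by auto
    have "norm (char M u) \<le> exp (- c * u\<^sup>2)" if "e \<le> \<bar>u\<bar>" "\<bar>u\<bar> \<le> A" for u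
    proof -
      have "u\<^sup>2 \<le> A\<^sup>2" using that A by (intro abs_le_square_iff[THEN iffD1]) auto
      then have "c * u\<^sup>2 \<le> c * A\<^sup>2"
        using r A by (intro mult_left_mono) (auto simp: c_def divide_nonpos_pos)
      also have "c * A\<^sup>2 = - ln r" using A by (simp add: c_def)
      finally have "ln r \<le> - c * u\<^sup>2" by simp
      then have "exp (ln r) \<le> exp (- c * u\<^sup>2)" by (simp only: exp_le_cancel_iff)
      then have "r \<le> exp (- c * u\<^sup>2)" using r by simp
      then show ?thesis using w(2)[OF that] by (simp add: r_def)
    qed
    moreover have "c > 0" using r A by (simp add: c_def divide_neg_pos)
    ultimately show ?thesis by auto
  qed
  then obtain c where c: "c > 0" "\<And>u. e \<le> \<bar>u\<bar> \<Longrightarrow> \<bar>u\<bar> \<le> A \<Longrightarrow> norm (char M u) \<le> exp (- c * u\<^sup>2)"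
    by auto
  show thesis
  proof
    show "0 < min c (v / 4)" using c v by simp
    fix u assume u: "\<bar>u\<bar> \<le> A"
    have "norm (char M u) \<le> exp (- c * u\<^sup>2) \<or> norm (char M u) \<le> exp (- (v / 4) * u\<^sup>2)"
      using small[of u] c(2)[OF _ u] by linarith
    moreover have "exp (- c * u\<^sup>2) \<le> exp (- min c (v / 4) * u\<^sup>2)"
      "exp (- (v / 4) * u\<^sup>2) \<le> exp (- min c (v / 4) * u\<^sup>2)"
      unfolding exp_le_cancel_iff by (intro mult_right_mono; simp)+
    ultimately show "norm (char M u) \<le> exp (- min c (v / 4) * u\<^sup>2)" by linarith
  qed
qed

text \<open>
  This is the pointwise limit behind the central limit theorem, obtained by comparing the power with
  that of \<open>1 - t\<^sup>2 v / (2 n)\<close>.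
\<close>
lemma (in real_distribution) char_power_tendsto_gaussian:
  assumes m: "integrable M (\<lambda>x. x)" "expectation (\<lambda>x. x) = 0" "integrable M (\<lambda>x. x\<^sup>2)"
    and var: "variance (\<lambda>x. x) = v" and v: "v > 0"
  shows "(\<lambda>n. char M (t / sqrt (real n)) ^ n) \<longlonglongrightarrow> complex_of_real (exp (- (t\<^sup>2 * v / 2)))"
proof (cases "t = 0")
  case True
  then show ?thesis by (simp add: char_zero)
next
  case False
  let ?t = "\<lambda>n. t / sqrt (real n)"
  let ?q = "\<lambda>n. complex_of_real (1 + (- (t\<^sup>2 * v / 2)) / real n)"
  let ?r = "\<lambda>t. (char M t - complex_of_real (1 - t\<^sup>2 * v / 2)) / complex_of_real (t\<^sup>2)"
  have "?t \<longlonglongrightarrow> 0"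
    by (intro tendsto_divide_0[OF tendsto_const] filterlim_at_top_imp_at_infinity
        filterlim_compose[OF sqrt_at_top filterlim_real_sequentially])
  moreover have "\<forall>\<^sub>F n in sequentially. ?t n \<noteq> 0"
    using eventually_gt_at_top[of 0] by eventually_elim (use False in simp)
  ultimately have "filterlim ?t (at 0) sequentially"
    by (rule filterlim_atI)
  then have lim0: "(\<lambda>n. t\<^sup>2 * norm (?r (?t n))) \<longlonglongrightarrow> 0"
    by (intro tendsto_mult_right_zero tendsto_norm_zero
        filterlim_compose[OF char_second_order[OF m var]])
  have "\<forall>\<^sub>F n in sequentially. norm (char M (?t n) ^ n - ?q n ^ n) \<le> t\<^sup>2 * norm (?r (?t n))"
    using eventually_ge_at_top[of "max 1 (nat \<lceil>t\<^sup>2 * v\<rceil>)"]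
  proof eventually_elim
    case (elim n)
    then have n: "n > 0" "t\<^sup>2 * v \<le> real n" by (auto simp: nat_ceiling_le_eq)
    have q: "?q n = complex_of_real (1 - (?t n)\<^sup>2 * v / 2)"
      using n by (simp add: power_divide)
    have "\<bar>1 + (- (t\<^sup>2 * v / 2)) / real n\<bar> \<le> 1"
      using n v by (auto simp: abs_le_iff field_simps)
    then have "norm (?q n) \<le> 1" by (simp only: norm_of_real)
    then have "norm (char M (?t n) ^ n - ?q n ^ n) \<le> n * norm (char M (?t n) - ?q n)"
      by (intro norm_power_diff cmod_char_le_1)
    also have "\<dots> = t\<^sup>2 * norm (?r (?t n))"
      unfolding q norm_divide norm_of_real using n False by (simp add: power_divide del: of_real_diff)
    finally show ?case .
  qed
  then have "(\<lambda>n. char M (?t n) ^ n - ?q n ^ n) \<longlonglongrightarrow> 0"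
    using lim0 by (rule Lim_null_comparison)
  moreover have "(\<lambda>n. complex_of_real ((1 + (- (t\<^sup>2 * v / 2)) / real n) ^ n)) \<longlonglongrightarrow> complex_of_real (exp (- (t\<^sup>2 * v / 2)))"
    by (intro tendsto_of_real tendsto_exp_limit_sequentially)
  then have "(\<lambda>n. ?q n ^ n) \<longlonglongrightarrow> complex_of_real (exp (- (t\<^sup>2 * v / 2)))"
    by (simp only: of_real_power)
  ultimately show ?thesis
    by (rule Lim_transform[rotated])
qed

text \<open>
  If the modulus is \<open>1\<close> at \<open>u\<close>, then \<open>cos (u x - \<theta>)\<close> has mean \<open>1\<close> for some phase \<open>\<theta>\<close>, hence is almost
  surely \<open>1\<close>; this puts \<open>x\<close> on a lattice with step \<open>2 \<pi> / |u|\<close>.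
\<close>
lemma (in real_distribution) norm_char_less_1:
  assumes nonlattice: "\<And>a h. h > 0 \<Longrightarrow> \<not> (AE x in M. x \<in> {a + of_int k * h | k :: int. True})"
    and u: "u \<noteq> 0"
  shows "norm (char M u) < 1"
proof (rule ccontr)
  assume "\<not> ?thesis"
  then have "norm (char M u) = 1" using cmod_char_le_1[of u] by simp
  then obtain \<theta> where \<theta>: "char M u = iexp \<theta>"
    by (metis complex_norm_eq_1_exp_eq)
  have int: "integrable M (\<lambda>x. iexp (u * x - \<theta>))"
    by (intro integrable_const_bound[where B=1]) auto
  have "(LINT x|M. 1 - cos (u * x - \<theta>)) = 1 - Re (CLINT x|M. iexp (u * x - \<theta>))"
  proof -
    have "integrable M (\<lambda>x. cos (u * x - \<theta>))"
      by (intro integrable_const_bound[where B=1]) auto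
    then have "(LINT x|M. 1 - cos (u * x - \<theta>)) = 1 - (LINT x|M. cos (u * x - \<theta>))"
      using prob_space by simp
    also have "(LINT x|M. cos (u * x - \<theta>)) = (LINT x|M. Re (iexp (u * x - \<theta>)))"
      by (simp add: Re_exp)
    also have "\<dots> = Re (CLINT x|M. iexp (u * x - \<theta>))"
      using int by (rule integral_Re)
    finally show ?thesis .
  qed
  also have "(CLINT x|M. iexp (u * x - \<theta>)) = (CLINT x|M. iexp (u * x) * iexp (- \<theta>))"
    by (simp add: exp_add[symmetric] algebra_simps)
  also have "\<dots> = char M u * iexp (- \<theta>)"
    by (simp add: char_def)
  also have "\<dots> = 1"
    unfolding \<theta> by (simp add: exp_add[symmetric])
  finally have "(LINT x|M. 1 - cos (u * x - \<theta>)) = 0" by simp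
  moreover have "integrable M (\<lambda>x. 1 - cos (u * x - \<theta>))"
    using cos_ge_minus_one by (intro integrable_const_bound[where B=2] AE_I2) (auto simp: abs_le_iff add.commute)
  ultimately have "AE x in M. 1 - cos (u * x - \<theta>) = 0"
    by (subst (asm) integral_nonneg_eq_0_iff_AE) simp_all
  then have "AE x in M. x \<in> {\<theta> / u + of_int k * (2 * pi / \<bar>u\<bar>) | k :: int. True}"
  proof eventually_elim
    case (elim x)
    then have "cos (u * x - \<theta>) = 1" by simp
    then obtain n :: int where n: "u * x - \<theta> = of_int n * 2 * pi"
      by (auto simp: cos_one_2pi_int)
    define k where "k = (if u > 0 then n else - n)"
    have "x = \<theta> / u + of_int n * 2 * pi / u"
      using n u by (simp add: field_simps)
    also have "of_int n * 2 * pi / u = of_int k * (2 * pi / \<bar>u\<bar>)"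
      using u by (auto simp: k_def field_simps)
    finally show ?case by blast
  qed
  moreover have "2 * pi / \<bar>u\<bar> > 0" using u by simp
  ultimately show False using nonlattice by blast
qed

text \<open>
  Centring the law pulls the oscillating factor \<open>iexp (u * m)\<close> out of the characteristic function.
  What remains has both the domination and the limit that are needed under the Fourier integral. The
  variance is positive because a constant is a lattice variable.
\<close>
lemma (in real_distribution) centred_char_asymptotics:
  assumes m: "integrable M (\<lambda>x. x)" "expectation (\<lambda>x. x) = m" "integrable M (\<lambda>x. x\<^sup>2)"
    and nonlattice: "\<forall>a h. h > 0 \<longrightarrow> \<not> (AE x in M. x \<in> {a + of_int k * h | k :: int. True})"
  shows "\<exists>\<phi> v. v > 0 \<and> \<phi> \<in> borel_measurable borel \<and> (\<forall>u. char M u = iexp (u * m) * \<phi> u)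
    \<and> (\<forall>A. \<exists>c>0. \<forall>u. \<bar>u\<bar> \<le> A \<longrightarrow> norm (\<phi> u) \<le> exp (- c * u\<^sup>2))
    \<and> (\<forall>t. (\<lambda>n. \<phi> (t / sqrt (real n)) ^ n) \<longlonglongrightarrow> complex_of_real (exp (- (t\<^sup>2 * v / 2))))"
proof -
  define M0 where "M0 = distr M borel (\<lambda>x. x - m)"
  interpret M0: real_distribution M0
    unfolding M0_def by (rule real_distribution_distr) simp
  have shift [measurable]: "(\<lambda>x. x - m) \<in> borel_measurable M"
    by measurable
  have intd: "integrable M (\<lambda>x. x - m)"
    by (rule Bochner_Integration.integrable_diff[OF m(1) integrable_const])
  have int0: "integrable M0 (\<lambda>x. x)"
    unfolding M0_def by (rule integrable_distr_eq[THEN iffD2, OF shift _ intd]) measurable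
  have mean0: "M0.expectation (\<lambda>x. x) = 0"
  proof -
    have "M0.expectation (\<lambda>x. x) = (LINT x|M. x - m)"
      unfolding M0_def by (rule integral_distr[OF shift]) measurable
    also have "\<dots> = (LINT x|M. x) - (LINT x|M. m)"
      by (rule Bochner_Integration.integral_diff[OF m(1) integrable_const])
    also have "\<dots> = 0"
      using m(2) prob_space by simp
    finally show ?thesis .
  qed
  have sq0: "integrable M0 (\<lambda>x. x\<^sup>2)"
  proof -
    have "integrable M (\<lambda>x. x\<^sup>2 + m\<^sup>2 - 2 * x * m)"
      by (intro Bochner_Integration.integrable_diff Bochner_Integration.integrable_add m(3)
          integrable_mult_left integrable_mult_right m(1) integrable_const)
    then have "integrable M (\<lambda>x. (x - m)\<^sup>2)"
      by (simp only: power2_diff)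
    then show ?thesis
      unfolding M0_def by (rule integrable_distr_eq[THEN iffD2, OF shift, rotated]) measurable
  qed
  have nonlattice0: "\<not> (AE x in M0. x \<in> {a + of_int k * h | k :: int. True})" if "h > 0" for a h
  proof
    assume "AE x in M0. x \<in> {a + of_int k * h | k :: int. True}"
    then have "AE x in M. x - m \<in> {a + of_int k * h | k :: int. True}"
      unfolding M0_def by (rule AE_distrD[OF shift])
    then have "AE x in M. x \<in> {(a + m) + of_int k * h | k :: int. True}"
    proof (rule AE_mp, intro AE_I2 impI)
      fix x assume "x - m \<in> {a + of_int k * h | k :: int. True}"
      then obtain k :: int where "x - m = a + of_int k * h" by blast
      then have "x = (a + m) + of_int k * h" by linarith
      then show "x \<in> {(a + m) + of_int k * h | k :: int. True}" by blast
    qed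
    then show False by (rule nonlattice[rule_format, OF that, THEN notE])
  qed
  have strict: "norm (char M0 u) < 1" if "u \<noteq> 0" for u
    by (rule M0.norm_char_less_1[OF nonlattice0 that])
  define v where "v = M0.variance (\<lambda>x. x)"
  have v_eq: "v = M0.expectation (\<lambda>x. x\<^sup>2)"
    by (simp add: v_def mean0)
  have v: "v > 0"
  proof (rule ccontr)
    assume "\<not> ?thesis"
    moreover have "v \<ge> 0" unfolding v_eq by (intro integral_nonneg_AE) simp
    ultimately have "M0.expectation (\<lambda>x. x\<^sup>2) = 0" unfolding v_eq by linarith
    then have "AE x in M0. x\<^sup>2 = 0"
      by (rule integral_nonneg_eq_0_iff_AE[THEN iffD1, OF sq0, rotated]) simp
    then have "AE x in M0. x \<in> {0 + of_int k * 1 | k :: int. True}"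
    proof (rule AE_mp, intro AE_I2 impI)
      fix x :: real assume "x\<^sup>2 = 0"
      then have "x = 0 + of_int 0 * 1" by simp
      then show "x \<in> {0 + of_int k * 1 | k :: int. True}" by blast
    qed
    then show False by (rule nonlattice0[OF zero_less_one, THEN notE])
  qed
  have char_eq: "char M u = iexp (u * m) * char M0 u" for u
  proof -
    have "char M0 u = (CLINT x|M. iexp (u * (x - m)))"
      unfolding M0_def char_def by (subst integral_distr) auto
    also have "\<dots> = (CLINT x|M. iexp (- (u * m)) * iexp (u * x))"
      by (simp add: exp_add[symmetric] algebra_simps)
    also have "\<dots> = iexp (- (u * m)) * char M u"
      by (simp add: char_def)
    finally show ?thesis by (simp add: exp_add[symmetric] mult.assoc[symmetric])
  qed

  show ?thesis
  proof (rule exI[of _ "char M0"], rule exI[of _ v], intro conjI allI)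
    show "\<exists>c>0. \<forall>u. \<bar>u\<bar> \<le> A \<longrightarrow> norm (char M0 u) \<le> exp (- c * u\<^sup>2)" for A
      using M0.char_gaussian_bound[OF int0 mean0 sq0 v_def[symmetric] v strict] by metis
    show "(\<lambda>n. char M0 (t / sqrt (real n)) ^ n) \<longlonglongrightarrow> complex_of_real (exp (- (t\<^sup>2 * v / 2)))" for t
      by (rule M0.char_power_tendsto_gaussian[OF int0 mean0 sq0 v_def[symmetric] v])
  qed (rule v M0.char_measurable char_eq)+
qed

section \<open>Convolution powers, exponential tilting and smoothing\<close>

primrec conv_pow :: "real measure \<Rightarrow> nat \<Rightarrow> real measure" where
  "conv_pow M 0 = return borel 0"
| "conv_pow M (Suc n) = (M \<star> conv_pow M n)"

lemma real_distribution_convolution: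
  assumes "real_distribution M" "real_distribution N"
  shows "real_distribution (M \<star> N)"
proof -
  interpret M: real_distribution M by fact
  interpret N: real_distribution N by fact
  interpret pair_prob_space M N ..
  show ?thesis
    unfolding convolution_def by (rule P.real_distribution_distr) measurable
qed

lemma char_convolution:
  assumes "real_distribution M" "real_distribution N"
  shows "char (M \<star> N) t = char M t * char N t"
proof -
  interpret M: real_distribution M by fact
  interpret N: real_distribution N by fact
  interpret pair_prob_space M N ..
  have "char (M \<star> N) t = (CLINT z|M \<Otimes>\<^sub>M N. iexp (t * (fst z + snd z)))"
    unfolding char_def convolution_def by (subst integral_distr) (simp_all add: case_prod_beta)
  also have "\<dots> = (CLINT x|M. CLINT y|N. iexp (t * (fst (x, y) + snd (x, y))))"
    by (intro integral_fst'[symmetric] P.integrable_const_bound[where B=1]) auto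
  also have "\<dots> = (CLINT x|M. CLINT y|N. iexp (t * x) * iexp (t * y))"
    by (simp add: algebra_simps exp_add)
  also have "\<dots> = char M t * char N t"
    by (simp add: char_def)
  finally show ?thesis .
qed

lemma real_distribution_conv_pow:
  assumes "real_distribution M"
  shows "real_distribution (conv_pow M n)"
proof (induction n)
  case 0
  show ?case
    by (auto simp: real_distribution_def real_distribution_axioms_def intro!: prob_space_return)
qed (simp add: assms real_distribution_convolution)

lemma char_conv_pow:
  assumes "real_distribution M"
  shows "char (conv_pow M n) t = char M t ^ n"
proof (induction n)
  case 0
  show ?case
    by (simp add: char_def integral_return)
qed (simp add: assms char_convolution real_distribution_conv_pow)

text \<open>
  Tilting commutes with convolution because \<open>exp\<close> turns sums into products.
\<close>
lemma conv_pow_exponential_tilt: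
  assumes \<nu>: "real_distribution \<nu>" and tilt: "real_distribution (density \<nu> (\<lambda>x. ennreal (exp x)))"
  shows "conv_pow (density \<nu> (\<lambda>x. ennreal (exp x))) n = density (conv_pow \<nu> n) (\<lambda>x. ennreal (exp x))"
proof (induction n)
  case 0
  show ?case
  proof (rule measure_eqI)
    fix A assume "A \<in> sets (conv_pow (density \<nu> (\<lambda>x. ennreal (exp x))) 0)"
    then have [measurable]: "A \<in> sets borel" by simp
    show "emeasure (conv_pow (density \<nu> (\<lambda>x. ennreal (exp x))) 0) A
      = emeasure (density (conv_pow \<nu> 0) (\<lambda>x. ennreal (exp x))) A"
      by (simp add: emeasure_density nn_integral_return)
  qed simp
next
  case (Suc n)
  let ?e = "\<lambda>x::real. ennreal (exp x)"
  interpret \<nu>: real_distribution \<nu> by fact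
  interpret \<mu>: real_distribution "density \<nu> ?e" by fact
  interpret \<nu>n: real_distribution "conv_pow \<nu> n" by (rule real_distribution_conv_pow[OF \<nu>])
  interpret \<mu>n: real_distribution "conv_pow (density \<nu> ?e) n" by (rule real_distribution_conv_pow[OF tilt])
  show ?case
  proof (rule measure_eqI)
    fix A assume "A \<in> sets (conv_pow (density \<nu> ?e) (Suc n))"
    then have [measurable]: "A \<in> sets borel" by simp
    have "emeasure (conv_pow (density \<nu> ?e) (Suc n)) A
        = (\<integral>\<^sup>+x. indicator A x \<partial>(density \<nu> ?e \<star> conv_pow (density \<nu> ?e) n))"
      by simp
    also have "\<dots> = (\<integral>\<^sup>+x. \<integral>\<^sup>+y. indicator A (x + y) \<partial>conv_pow (density \<nu> ?e) n \<partial>density \<nu> ?e)"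
      by (rule nn_integral_convolution) (auto intro: \<mu>.finite_measure_axioms \<mu>n.finite_measure_axioms)
    also have "\<dots> = (\<integral>\<^sup>+x. ?e x * (\<integral>\<^sup>+y. ?e y * indicator A (x + y) \<partial>conv_pow \<nu> n) \<partial>\<nu>)"
      unfolding Suc by (simp add: nn_integral_density)
    also have "\<dots> = (\<integral>\<^sup>+x. \<integral>\<^sup>+y. ?e (x + y) * indicator A (x + y) \<partial>conv_pow \<nu> n \<partial>\<nu>)"
      by (simp add: nn_integral_cmult[symmetric] exp_add ennreal_mult mult_ac)
    also have "\<dots> = (\<integral>\<^sup>+x. ?e x * indicator A x \<partial>(\<nu> \<star> conv_pow \<nu> n))"
      by (rule nn_integral_convolution[symmetric])
         (auto intro: \<nu>.finite_measure_axioms \<nu>n.finite_measure_axioms)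
    also have "\<dots> = emeasure (density (conv_pow \<nu> (Suc n)) ?e) A"
      by (simp add: emeasure_density)
    finally show "emeasure (conv_pow (density \<nu> ?e) (Suc n)) A
        = emeasure (density (conv_pow \<nu> (Suc n)) ?e) A" .
  qed simp
qed

text \<open>
  Its density \<open>exp y\<close> on the negative half-line is the kernel which, convolved with a tilted law,
  turns tail probabilities into values of a density.
\<close>
definition neg_exponential :: "real measure" where
  "neg_exponential = distr (density lborel (exponential_density 1)) borel uminus"

lemma real_distribution_neg_exponential: "real_distribution neg_exponential"
proof -
  interpret prob_space "density lborel (exponential_density 1)"
    by (rule prob_space_exponential_density) simp
  show ?thesis
    unfolding neg_exponential_def by (rule real_distribution_distr) simp
qed

lemma convolution_neg_exponential:
  assumes "real_distribution M"
  shows "(M \<star> neg_exponential)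
    = density lborel (\<lambda>s. \<integral>\<^sup>+w. ennreal (exponential_density 1 (w - s)) \<partial>M)"
proof (rule measure_eqI)
  interpret M: real_distribution M by fact
  interpret E: real_distribution neg_exponential by (rule real_distribution_neg_exponential)
  interpret pair_sigma_finite M lborel ..
  fix A assume "A \<in> sets (M \<star> neg_exponential)"
  then have [measurable]: "A \<in> sets borel" by simp
  have "emeasure (M \<star> neg_exponential) A = (\<integral>\<^sup>+x. indicator A x \<partial>(M \<star> neg_exponential))"
    by simp
  also have "\<dots> = (\<integral>\<^sup>+w. \<integral>\<^sup>+y. indicator A (w + y) \<partial>neg_exponential \<partial>M)"
    by (rule nn_integral_convolution) (auto intro: M.finite_measure_axioms E.finite_measure_axioms)
  also have "\<dots> = (\<integral>\<^sup>+w. \<integral>\<^sup>+y. ennreal (exponential_density 1 y) * indicator A (w - y) \<partial>lborel \<partial>M)"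
    unfolding neg_exponential_def by (simp add: nn_integral_distr nn_integral_density)
  also have "\<dots> = (\<integral>\<^sup>+w. \<integral>\<^sup>+s. ennreal (exponential_density 1 (w - s)) * indicator A s \<partial>lborel \<partial>M)"
  proof (rule nn_integral_cong)
    fix w
    show "(\<integral>\<^sup>+y. ennreal (exponential_density 1 y) * indicator A (w - y) \<partial>lborel)
      = (\<integral>\<^sup>+s. ennreal (exponential_density 1 (w - s)) * indicator A s \<partial>lborel)"
      by (subst nn_integral_real_affine[where c="-1" and t=w]) simp_all
  qed
  also have "\<dots> = (\<integral>\<^sup>+s. \<integral>\<^sup>+w. ennreal (exponential_density 1 (w - s)) * indicator A s \<partial>M \<partial>lborel)"
    by (rule Fubini'[symmetric]) measurable
  also have "\<dots> = emeasure (density lborel (\<lambda>s. \<integral>\<^sup>+w. ennreal (exponential_density 1 (w - s)) \<partial>M)) A"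
    by (simp add: emeasure_density nn_integral_multc)
  finally show "emeasure (M \<star> neg_exponential) A
      = emeasure (density lborel (\<lambda>s. \<integral>\<^sup>+w. ennreal (exponential_density 1 (w - s)) \<partial>M)) A" .
qed simp

text \<open>
  The exponential density at \<open>w - s\<close> is \<open>exp (s - w)\<close> for \<open>w \<ge> s\<close>; the tilting factor \<open>exp w\<close> cancels
  the dependence on \<open>w\<close>, so only the tail of \<open>\<nu>\<close> remains.
\<close>
lemma tilted_convolution_neg_exponential:
  assumes \<nu>: "real_distribution \<nu>" and tilt: "real_distribution (density \<nu> (\<lambda>x. ennreal (exp x)))"
  shows "(density \<nu> (\<lambda>x. ennreal (exp x)) \<star> neg_exponential)
    = density lborel (\<lambda>s. ennreal (exp s * measure \<nu> {s..}))"
proof -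
  interpret \<nu>: real_distribution \<nu> by fact
  have "(\<integral>\<^sup>+w. ennreal (exponential_density 1 (w - s)) \<partial>density \<nu> (\<lambda>x. ennreal (exp x)))
      = ennreal (exp s * measure \<nu> {s..})" for s
  proof -
    have "(\<integral>\<^sup>+w. ennreal (exponential_density 1 (w - s)) \<partial>density \<nu> (\<lambda>x. ennreal (exp x)))
        = (\<integral>\<^sup>+w. ennreal (exp w) * ennreal (exponential_density 1 (w - s)) \<partial>\<nu>)"
      by (rule nn_integral_density) simp_all
    also have "\<dots> = (\<integral>\<^sup>+w. ennreal (exp s) * indicator {s..} w \<partial>\<nu>)"
      by (intro nn_integral_cong)
         (auto simp: exponential_density_def indicator_def ennreal_mult[symmetric] exp_add[symmetric])
    also have "\<dots> = ennreal (exp s * measure \<nu> {s..})"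
      by (simp add: nn_integral_cmult_indicator \<nu>.emeasure_eq_measure ennreal_mult)
    finally show ?thesis .
  qed
  then show ?thesis
    using convolution_neg_exponential[OF tilt] by simp
qed

text \<open>
  Fubini for the cosine transform defining the kernel; the tent makes everything absolutely
  integrable.
\<close>
lemma (in real_distribution) fejer_fourier:
  "(LINT s|M. fejer (a * (T - s)))
    = (LINT u|lborel. tent u * Re (iexp (- (u * a * T)) * char M (u * a)))"
proof -
  interpret L: pair_sigma_finite M lborel ..
  let ?f = "\<lambda>s u. tent u * cos (u * (a * (T - s)))"
  have int_u: "integrable lborel (?f s)" for s
    by (rule Bochner_Integration.integrable_bound[OF integrable_tent])
       (auto simp: abs_mult mult_left_le)
  have int: "integrable (M \<Otimes>\<^sub>M lborel) (\<lambda>(s, u). ?f s u)"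
  proof (rule L.Fubini_integrable)
    show "AE s in M. integrable lborel (\<lambda>u. (\<lambda>(s, u). ?f s u) (s, u))"
      using int_u by simp
    show "integrable M (\<lambda>s. LINT u|lborel. norm ((\<lambda>(s, u). ?f s u) (s, u)))"
    proof (rule integrable_const_bound[where B="LINT u|lborel. tent u"])
      show "AE s in M. norm (LINT u|lborel. norm ((\<lambda>(s, u). ?f s u) (s, u))) \<le> (LINT u|lborel. tent u)"
      proof (intro AE_I2)
        fix s
        have "(LINT u|lborel. norm (?f s u)) \<le> (LINT u|lborel. tent u)"
          using int_u by (intro integral_mono integrable_norm integrable_tent)
             (auto simp: abs_mult tent_bounds mult_left_le)
        then show "norm (LINT u|lborel. norm ((\<lambda>(s, u). ?f s u) (s, u))) \<le> (LINT u|lborel. tent u)"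
          by simp
      qed
    qed measurable
  qed measurable
  have "(LINT s|M. fejer (a * (T - s))) = (LINT s|M. LINT u|lborel. ?f s u)"
    by (simp add: fejer_def)
  also have "\<dots> = (LINT u|lborel. LINT s|M. ?f s u)"
    by (rule L.Fubini_integral[OF int, symmetric])
  also have "\<dots> = (LINT u|lborel. tent u * Re (iexp (- (u * a * T)) * char M (u * a)))"
  proof (rule Bochner_Integration.integral_cong[OF refl])
    fix u
    have "(LINT s|M. cos (u * (a * (T - s)))) = (LINT s|M. Re (iexp (- (u * a * T)) * iexp (u * a * s)))"
    proof (rule Bochner_Integration.integral_cong[OF refl])
      fix s
      have "iexp (- (u * a * T)) * iexp (u * a * s) = iexp (- (u * (a * (T - s))))"
        by (simp add: exp_add[symmetric] algebra_simps)
      then show "cos (u * (a * (T - s))) = Re (iexp (- (u * a * T)) * iexp (u * a * s))"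
        by (simp add: Re_exp)
    qed
    also have "\<dots> = Re (CLINT s|M. iexp (- (u * a * T)) * iexp (u * a * s))"
      by (intro integral_Re integrable_mult_right integrable_const_bound[where B=1]) auto
    also have "\<dots> = Re (iexp (- (u * a * T)) * char M (u * a))"
      by (simp add: char_def)
    finally show "(LINT s|M. ?f s u) = tent u * Re (iexp (- (u * a * T)) * char M (u * a))"
      by simp
  qed
  finally show ?thesis .
qed

lemma integrable_fejer_smoothing:
  fixes F :: "real \<Rightarrow> real"
  assumes F: "integrable lborel F" and a: "a > 0"
  shows "integrable lborel (\<lambda>x. fejer x * (r * F (T - x / a)))"
proof (rule Bochner_Integration.integrable_bound)
  have "integrable lborel (\<lambda>x. F (T + (- (1 / a)) * x))"
    using a by (intro lborel_integrable_real_affine[OF F]) simp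
  then show "integrable lborel (\<lambda>x. 2 * r * F (T - x / a))"
    by simp
  have "\<bar>fejer x\<bar> \<le> 2" for x
    using fejer_nonneg[of x] fejer_le_2[of x] by simp
  then show "AE x in lborel. norm (fejer x * (r * F (T - x / a))) \<le> norm (2 * r * F (T - x / a))"
    by (intro AE_I2) (simp add: abs_mult mult_right_mono mult.assoc)
  have [measurable]: "F \<in> borel_measurable borel"
    using borel_measurable_integrable[OF F] by simp
  show "(\<lambda>x. fejer x * (r * F (T - x / a))) \<in> borel_measurable lborel"
    by measurable
qed

text \<open>
  Averages of a density against the rescaled kernel, in the form that takes the limit: the frequency
  is measured in units of \<open>1 / r\<close>, where later \<open>r = sqrt N\<close>.
\<close>
lemma fejer_smoothing_fourier:
  fixes F :: "real \<Rightarrow> real"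
  assumes \<rho>: "real_distribution \<rho>" "\<rho> = density lborel (\<lambda>s. ennreal (F s))"
    and F [measurable]: "F \<in> borel_measurable borel" "\<And>s. 0 \<le> F s"
    and a: "a > 0" and r: "r > 0"
  shows "(LINT x|lborel. fejer x * (r * F (T - x / a)))
    = (LINT v|lborel. tent (v / (a * r)) * Re (iexp (- (v / r * T)) * char \<rho> (v / r)))"
proof -
  interpret real_distribution \<rho> by fact
  have "(LINT x|lborel. fejer x * (r * F (T - x / a)))
      = a * (LINT s|lborel. fejer (a * (T - s)) * (r * F s))"
    using a by (subst lborel_integral_real_affine[where c="-a" and t="a * T"])
      (simp_all add: algebra_simps diff_divide_distrib)
  also have "\<dots> = a * r * (LINT s|lborel. F s * fejer (a * (T - s)))"
    by (simp add: mult_ac)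
  also have "(LINT s|lborel. F s * fejer (a * (T - s))) = (LINT s|\<rho>. fejer (a * (T - s)))"
    unfolding \<rho>(2) by (subst integral_real_density) (auto simp: F)
  also have "\<dots> = (LINT u|lborel. tent u * Re (iexp (- (u * a * T)) * char \<rho> (u * a)))"
    by (rule fejer_fourier)
  also have "\<dots> = 1 / (a * r) * (LINT v|lborel. tent (v / (a * r)) * Re (iexp (- (v / r * T)) * char \<rho> (v / r)))"
    using a r by (subst lborel_integral_real_affine[where c="1 / (a * r)" and t=0]) simp_all
  finally show ?thesis using a r by simp
qed

section \<open>Exact asymptotics of the tail\<close>

lemma integrable_gaussian:
  assumes "c > 0"
  shows "integrable lborel (\<lambda>v::real. exp (- c * v\<^sup>2))"
    and "0 < (LINT v|lborel. exp (- c * v\<^sup>2))"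
proof -
  define \<sigma> where "\<sigma> = sqrt (1 / (2 * c))"
  have \<sigma>: "0 < \<sigma>" "\<sigma>\<^sup>2 = 1 / (2 * c)"
    using assms by (auto simp: \<sigma>_def)
  define b where "b = sqrt (2 * pi * \<sigma>\<^sup>2)"
  have b: "b > 0" using \<sigma>(1) by (simp add: b_def)
  have eq: "exp (- c * v\<^sup>2) = b * normal_density 0 \<sigma> v" for v
    using assms b by (simp add: normal_density_def b_def[symmetric]) (simp add: \<sigma>(2))
  show "integrable lborel (\<lambda>v::real. exp (- c * v\<^sup>2))"
    unfolding eq using \<sigma>(1) by simp
  show "0 < (LINT v|lborel. exp (- c * v\<^sup>2))"
    unfolding eq using \<sigma>(1) b by simp
qed

text \<open>
  The constant \<open>c\<close> is a Gaussian integral divided by the mass of the Fejer kernel. Its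
  positivity is what allows two tails to be divided.
\<close>
lemma exact_tail_asymptotics:
  assumes \<nu>: "real_distribution \<nu>"
  defines "\<mu> \<equiv> density \<nu> (\<lambda>x. ennreal (exp x))"
  assumes \<mu>: "real_distribution \<mu>"
    and m: "integrable \<mu> (\<lambda>x. x)" "(LINT x|\<mu>. x) = m" "integrable \<mu> (\<lambda>x. x\<^sup>2)"
    and nonlattice: "\<forall>a h. h > 0 \<longrightarrow> \<not> (AE x in \<mu>. x \<in> {a + of_int k * h | k :: int. True})"
  shows "\<exists>c>0. \<forall>T. (\<lambda>N. (T N - real N * m) / sqrt (real N)) \<longlonglongrightarrow> 0 \<longrightarrow>
    (\<lambda>N. sqrt (real N) * (exp (T N) * measure (conv_pow \<nu> N) {T N..})) \<longlonglongrightarrow> c"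
proof -
  interpret \<nu>: real_distribution \<nu> by (rule \<nu>)
  interpret \<mu>: real_distribution \<mu> by (rule \<mu>)
  obtain \<phi> v where v: "v > 0" and \<phi>_meas [measurable]: "\<phi> \<in> borel_measurable borel"
    and char_\<mu>: "\<forall>u. char \<mu> u = iexp (u * m) * \<phi> u"
    and \<phi>_bound: "\<forall>A. \<exists>c>0. \<forall>u. \<bar>u\<bar> \<le> A \<longrightarrow> norm (\<phi> u) \<le> exp (- c * u\<^sup>2)"
    and \<phi>_lim: "\<forall>t. (\<lambda>n. \<phi> (t / sqrt (real n)) ^ n) \<longlonglongrightarrow> complex_of_real (exp (- (t\<^sup>2 * v / 2)))"
    using \<mu>.centred_char_asymptotics[OF m nonlattice] by (elim exE conjE)
  define \<rho> where "\<rho> N = (conv_pow \<mu> N \<star> neg_exponential)" for N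
  define F where "F N s = exp s * measure (conv_pow \<nu> N) {s..}" for N s
  have \<rho>: "real_distribution (\<rho> N)" for N
    unfolding \<rho>_def
    by (intro real_distribution_convolution real_distribution_conv_pow \<mu> real_distribution_neg_exponential)
  have char_\<rho>: "char (\<rho> N) u = char \<mu> u ^ N * char neg_exponential u" for N u
    unfolding \<rho>_def
    by (simp add: char_convolution char_conv_pow real_distribution_conv_pow \<mu> real_distribution_neg_exponential)
  have tilt: "conv_pow \<mu> N = density (conv_pow \<nu> N) (\<lambda>x. ennreal (exp x))" for N
    using conv_pow_exponential_tilt[OF \<nu> \<mu>[unfolded \<mu>_def]] by (simp add: \<mu>_def)
  have \<rho>_density: "\<rho> N = density lborel (\<lambda>s. ennreal (F N s))" for N
    unfolding \<rho>_def F_def tilt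
    by (intro tilted_convolution_neg_exponential real_distribution_conv_pow \<nu>)
       (use real_distribution_conv_pow[OF \<mu>, of N] in \<open>simp add: tilt\<close>)
  have F_nonneg: "0 \<le> F N s" for N s by (simp add: F_def)
  have growth: "F N s' \<le> exp (s' - s) * F N s" if "s \<le> s'" for N s s'
  proof -
    interpret N: real_distribution "conv_pow \<nu> N" by (rule real_distribution_conv_pow[OF \<nu>])
    have "measure (conv_pow \<nu> N) {s'..} \<le> measure (conv_pow \<nu> N) {s..}"
      using that by (intro N.finite_measure_mono) auto
    then show ?thesis
      by (simp add: F_def mult.assoc[symmetric] exp_add[symmetric])
  qed
  have F_meas [measurable]: "F N \<in> borel_measurable borel" for N
  proof -
    interpret N: real_distribution "conv_pow \<nu> N" by (rule real_distribution_conv_pow[OF \<nu>])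
    have "antimono (\<lambda>s. measure (conv_pow \<nu> N) {s..})"
      by (intro antimonoI N.finite_measure_mono) auto
    then have "mono (\<lambda>s. - measure (conv_pow \<nu> N) {s..})"
      by (simp add: monotone_def)
    then have "(\<lambda>s. - (- measure (conv_pow \<nu> N) {s..})) \<in> borel_measurable borel"
      by (intro borel_measurable_uminus borel_measurable_mono)
    then have "(\<lambda>s. measure (conv_pow \<nu> N) {s..}) \<in> borel_measurable borel"
      by simp
    then show ?thesis
      unfolding F_def[abs_def] by measurable
  qed
  have F_int: "integrable lborel (F N)" for N
  proof -
    interpret R: real_distribution "\<rho> N" by (rule \<rho>)
    have "(\<integral>\<^sup>+s. ennreal (F N s) \<partial>lborel) = emeasure (\<rho> N) UNIV"
      unfolding \<rho>_density by (subst emeasure_density) auto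
    also have "\<dots> = 1"
      using R.emeasure_space_1 by simp
    finally show ?thesis
      by (intro integrableI_nonneg) (auto simp: F_nonneg)
  qed
  have "isCont (char neg_exponential) 0"
    by (intro real_distribution.isCont_char real_distribution_neg_exponential)
  then have ne_cont: "char neg_exponential \<midarrow>0\<rightarrow> 1"
    using real_distribution.char_zero[OF real_distribution_neg_exponential]
    by (simp add: isCont_def)

  \<comment> \<open>\<open>J\<close> is the smoothed density in the sense of the Tauberian lemma, \<open>f\<close> its Fourier integrand\<close>
  define J where "J k N s = (LINT x|lborel. fejer x * (sqrt (real N) * F N (s - x / (real k)\<^sup>2)))" for k N s
  define f where "f k N s w = tent (w / ((real k)\<^sup>2 * sqrt (real N)))
      * Re (iexp (- (w * ((s - real N * m) / sqrt (real N))))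
          * (\<phi> (w / sqrt (real N)) ^ N * char neg_exponential (w / sqrt (real N))))" for k N s w
  have J_eq: "J k N s = (LINT w|lborel. f k N s w)" if "k > 0" "N > 0" for k N s
  proof -
    have "J k N s = (LINT w|lborel. tent (w / ((real k)\<^sup>2 * sqrt (real N)))
        * Re (iexp (- (w / sqrt (real N) * s)) * char (\<rho> N) (w / sqrt (real N))))"
      unfolding J_def using that
      by (intro fejer_smoothing_fourier \<rho> \<rho>_density F_meas F_nonneg) auto
    also have "\<dots> = (LINT w|lborel. f k N s w)"
    proof (rule Bochner_Integration.integral_cong[OF refl])
      fix w
      let ?u = "w / sqrt (real N)"
      have "iexp (- (?u * s)) * iexp (?u * m) ^ N = iexp (- (w * ((s - real N * m) / sqrt (real N))))"
        by (simp add: exp_of_nat_mult[symmetric] exp_add[symmetric] algebra_simps diff_divide_distrib)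
      then have "iexp (- (?u * s)) * char (\<rho> N) ?u
          = iexp (- (w * ((s - real N * m) / sqrt (real N)))) * (\<phi> ?u ^ N * char neg_exponential ?u)"
        unfolding char_\<rho> char_\<mu>[rule_format] power_mult_distrib by (simp add: mult.assoc[symmetric])
      then show "tent (w / ((real k)\<^sup>2 * sqrt (real N))) * Re (iexp (- (?u * s)) * char (\<rho> N) ?u) = f k N s w"
        by (simp only: f_def)
    qed
    finally show ?thesis .
  qed
  have f_meas: "f k N s \<in> borel_measurable borel" for k N s
  proof -
    have [measurable]: "char neg_exponential \<in> borel_measurable borel"
      by (intro real_distribution.char_measurable real_distribution_neg_exponential)
    show ?thesis
      unfolding f_def[abs_def] by measurable
  qed
  have f_bound: "\<exists>c>0. \<forall>N>0. \<forall>s w. \<bar>f k N s w\<bar> \<le> exp (- c * w\<^sup>2)" if k: "k > 0" for k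
  proof -
    obtain c where c: "c > 0" "\<And>u. \<bar>u\<bar> \<le> (real k)\<^sup>2 \<Longrightarrow> norm (\<phi> u) \<le> exp (- c * u\<^sup>2)"
      using \<phi>_bound[rule_format, of "(real k)\<^sup>2"] by (elim exE conjE) (rule that, blast+)
    have "\<bar>f k N s w\<bar> \<le> exp (- c * w\<^sup>2)" if N: "N > 0" for N s w
    \<comment> \<open>outside the range covered by the Gaussian bound the tent vanishes\<close>
    proof (cases "\<bar>w / sqrt (real N)\<bar> \<le> (real k)\<^sup>2")
      case False
      then have "1 \<le> \<bar>w / ((real k)\<^sup>2 * sqrt (real N))\<bar>"
        using N k by (simp add: field_simps abs_mult)
      then show ?thesis by (simp add: f_def tent_def)
    next
      case True
      let ?u = "w / sqrt (real N)"
      have "norm (\<phi> ?u ^ N) \<le> exp (- c * ?u\<^sup>2) ^ N"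
        unfolding norm_power by (intro power_mono c(2) True) simp
      also have "\<dots> = exp (- c * w\<^sup>2)"
        using N by (simp add: exp_of_nat_mult[symmetric] power_divide)
      finally have 1: "norm (\<phi> ?u ^ N) \<le> exp (- c * w\<^sup>2)" .
      have 2: "norm (char neg_exponential ?u) \<le> 1"
        by (intro real_distribution.cmod_char_le_1 real_distribution_neg_exponential)
      have 3: "\<bar>tent (w / ((real k)\<^sup>2 * sqrt (real N)))\<bar> \<le> 1"
        by (auto simp: tent_def)
      let ?z = "iexp (- (w * ((s - real N * m) / sqrt (real N)))) * (\<phi> ?u ^ N * char neg_exponential ?u)"
      have "\<bar>Re ?z\<bar> \<le> norm ?z" by (rule abs_Re_le_cmod)
      also have "norm ?z = norm (\<phi> ?u ^ N) * norm (char neg_exponential ?u)"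
        unfolding norm_mult by simp
      also have "\<dots> \<le> exp (- c * w\<^sup>2) * 1"
        by (intro mult_mono 1 2) auto
      finally have "\<bar>Re ?z\<bar> \<le> exp (- c * w\<^sup>2)" by simp
      then have "\<bar>tent (w / ((real k)\<^sup>2 * sqrt (real N)))\<bar> * \<bar>Re ?z\<bar> \<le> 1 * exp (- c * w\<^sup>2)"
        using 3 by (intro mult_mono) auto
      then show ?thesis by (simp only: f_def abs_mult mult_1)
    qed
    with c(1) show ?thesis by blast
  qed
  define G where "G = (LINT w|lborel. exp (- (v / 2) * w\<^sup>2))"
  have G: "G > 0"
    unfolding G_def using v by (intro integrable_gaussian) simp
  define R where "R T \<longleftrightarrow> (\<lambda>N. (T N - real N * m) / sqrt (real N)) \<longlonglongrightarrow> 0" for T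
  have sqrt_inf: "filterlim (\<lambda>N. sqrt (real N)) at_infinity sequentially"
    by (intro filterlim_at_top_imp_at_infinity filterlim_compose[OF sqrt_at_top filterlim_real_sequentially])
  have f_lim: "(\<lambda>N. f k N (T N) w) \<longlonglongrightarrow> exp (- (v / 2) * w\<^sup>2)" if "R T" "k > 0" for k T w
  proof -
    have 1: "(\<lambda>N. w / sqrt (real N)) \<longlonglongrightarrow> 0"
      by (intro tendsto_divide_0[OF tendsto_const] sqrt_inf)
    have "(\<lambda>N. tent ((1 / (real k)\<^sup>2) * (w / sqrt (real N)))) \<longlonglongrightarrow> max 0 (1 - \<bar>(1 / (real k)\<^sup>2) * 0\<bar>)"
      unfolding tent_def by (intro tendsto_intros 1)
    then have 2: "(\<lambda>N. tent (w / ((real k)\<^sup>2 * sqrt (real N)))) \<longlonglongrightarrow> 1"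
      by simp
    have 3: "(\<lambda>N. char neg_exponential (w / sqrt (real N))) \<longlonglongrightarrow> 1"
      using isCont_tendsto_compose[OF real_distribution.isCont_char[OF real_distribution_neg_exponential] 1]
      by (simp add: real_distribution.char_zero[OF real_distribution_neg_exponential])
    have 4: "(\<lambda>N. \<phi> (w / sqrt (real N)) ^ N) \<longlonglongrightarrow> complex_of_real (exp (- (w\<^sup>2 * v / 2)))"
      by (rule \<phi>_lim[rule_format])
    have 5: "(\<lambda>N. iexp (- (w * ((T N - real N * m) / sqrt (real N))))) \<longlonglongrightarrow> iexp (- (w * 0))"
      using that(1) unfolding R_def by (intro tendsto_intros)
    have "(\<lambda>N. f k N (T N) w) \<longlonglongrightarrow> 1 * Re (iexp (- (w * 0)) * (complex_of_real (exp (- (w\<^sup>2 * v / 2))) * 1))"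
      unfolding f_def by (intro tendsto_mult tendsto_Re 2 3 4 5)
    then show ?thesis by (simp add: mult.commute)
  qed
  have limit: "(\<lambda>N. J k N (T N)) \<longlonglongrightarrow> G" if k: "k > 0" and T: "R T" for k T
  proof -
    obtain c where c: "c > 0" "\<And>N s w. N > 0 \<Longrightarrow> \<bar>f k N s w\<bar> \<le> exp (- c * w\<^sup>2)"
      using f_bound[OF k] by blast
    have "(\<lambda>N. LINT w|lborel. f k (Suc N) (T (Suc N)) w) \<longlonglongrightarrow> G"
      unfolding G_def
    proof (rule integral_dominated_convergence[where w="\<lambda>w. exp (- c * w\<^sup>2)"])
      show "AE w in lborel. (\<lambda>N. f k (Suc N) (T (Suc N)) w) \<longlonglongrightarrow> exp (- (v / 2) * w\<^sup>2)"
        by (intro AE_I2 LIMSEQ_Suc f_lim T k)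
      show "AE w in lborel. norm (f k (Suc N) (T (Suc N)) w) \<le> exp (- c * w\<^sup>2)" for N
        using c(2)[of "Suc N"] by simp
    qed (use integrable_gaussian[OF c(1)] f_meas in simp_all)
    then have "(\<lambda>N. J k (Suc N) (T (Suc N))) \<longlonglongrightarrow> G"
      using k by (simp add: J_eq)
    then show ?thesis by (rule LIMSEQ_imp_Suc)
  qed
  have bounded: "\<exists>B. \<forall>N>0. \<forall>s. J k N s \<le> B" if k: "k > 0" for k
  proof -
    obtain c where c: "c > 0" "\<And>N s w. N > 0 \<Longrightarrow> \<bar>f k N s w\<bar> \<le> exp (- c * w\<^sup>2)"
      using f_bound[OF k] by blast
    have "J k N s \<le> (LINT w|lborel. exp (- c * w\<^sup>2))" if N: "N > 0" for N s
      unfolding J_eq[OF k N]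
    proof (rule integral_mono)
      show "integrable lborel (f k N s)"
        by (rule Bochner_Integration.integrable_bound[OF integrable_gaussian(1)[OF c(1)]])
           (use f_meas c(2)[OF N] in auto)
      show "f k N s w \<le> exp (- c * w\<^sup>2)" for w
        using c(2)[OF N, of s w] by simp
    qed (rule integrable_gaussian(1)[OF c(1)])
    then show ?thesis by blast
  qed
  have "(\<lambda>N. sqrt (real N) * F N (T N)) \<longlonglongrightarrow> G / (LINT x|lborel. fejer x)" if T: "R T" for T
  proof (rule smoothing_tauberian[where K=fejer and p="\<lambda>N s. sqrt (real N) * F N s" and R=R])
    show "\<exists>B. \<forall>N>0. \<forall>T. (LINT x|lborel. fejer x * (sqrt (real N) * F N (T - x / (real k)\<^sup>2))) \<le> B"
      if "k > 0" for k :: nat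
      using bounded[OF that] by (simp add: J_def)
    show "(\<lambda>N. LINT x|lborel. fejer x * (sqrt (real N) * F N (T N - x / (real k)\<^sup>2))) \<longlonglongrightarrow> G"
      if "k > 0" "R T" for k :: nat and T
      using limit[OF that] by (simp add: J_def)
    show "R (\<lambda>N. T N + d)" if "R T" for T d
    proof -
      have "(\<lambda>N. (T N - real N * m) / sqrt (real N) + d / sqrt (real N)) \<longlonglongrightarrow> 0 + 0"
        using that unfolding R_def
        by (intro tendsto_add tendsto_divide_0[OF tendsto_const] sqrt_inf)
      then show ?thesis
        by (simp add: R_def add_divide_distrib[symmetric] algebra_simps)
    qed
    show "sqrt (real N) * F N s' \<le> exp (s' - s) * (sqrt (real N) * F N s)" if "s \<le> s'" for N s s'
      using mult_left_mono[OF growth[OF that, of N], of "sqrt (real N)"] by (simp add: mult_ac)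
    show "integrable lborel (\<lambda>x. fejer x * (sqrt (real N) * F N (T - x / (real k)\<^sup>2)))"
      if "k > 0" for k N :: nat and T
      using that by (intro integrable_fejer_smoothing F_int) simp
  qed (simp_all add: T F_nonneg fejer_nonneg fejer_integral_pos integrable_fejer)
  moreover have "G / (LINT x|lborel. fejer x) > 0"
    using G fejer_integral_pos by simp
  ultimately show ?thesis
    by (intro exI[of _ "G / (LINT x|lborel. fejer x)"]) (simp add: F_def R_def)
qed

text \<open>
  At \<open>T\<^sub>N = N m\<close> the tail is smaller than the level by a factor of order \<open>1 / sqrt N\<close>, and at
  \<open>T\<^sub>N = N m - ln N\<close> it is larger by a factor of order \<open>sqrt N\<close>. By monotonicity the threshold \<open>t N\<close> lies
  in between, close enough to \<open>N m\<close> for the asymptotics to apply to it and to \<open>t N - s\<close> after \<open>N - n\<close>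
  steps. The quotient of the two asymptotics is \<open>exp s\<close>.
\<close>
lemma tail_ratio_tendsto:
  fixes W :: "nat \<Rightarrow> real \<Rightarrow> real" and t :: "nat \<Rightarrow> real"
  assumes antitone: "\<And>N x y. x \<le> y \<Longrightarrow> W N y \<le> W N x"
    and c: "c > 0"
    and tail: "\<And>T. (\<lambda>N. (T N - real N * m) / sqrt (real N)) \<longlonglongrightarrow> 0 \<Longrightarrow>
      (\<lambda>N. sqrt (real N) * (exp (T N) * W N (T N))) \<longlonglongrightarrow> c"
    and level: "\<And>N. N \<ge> 1 \<Longrightarrow> W N (t N) = exp (- real N * m)"
  shows "(\<lambda>N. W (N - n) (t N - s) / exp (- real N * m)) \<longlonglongrightarrow> exp s"
proof -
  have ln_sqrt: "(\<lambda>N. ln (real N) / sqrt (real N)) \<longlonglongrightarrow> 0"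
    by real_asymp
  have below: "\<forall>\<^sub>F N in sequentially. t N \<le> real N * m"
  proof -
    have "(\<lambda>N. sqrt (real N) * (exp (real N * m) * W N (real N * m))) \<longlonglongrightarrow> c"
      by (intro tail) simp
    moreover have "(\<lambda>N. 1 / sqrt (real N)) \<longlonglongrightarrow> 0"
      by real_asymp
    ultimately have "(\<lambda>N. sqrt (real N) * (exp (real N * m) * W N (real N * m)) * (1 / sqrt (real N))) \<longlonglongrightarrow> c * 0"
      by (rule tendsto_mult)
    then have "\<forall>\<^sub>F N in sequentially. sqrt (real N) * (exp (real N * m) * W N (real N * m)) * (1 / sqrt (real N)) < 1"
      by (rule order_tendstoD(2)) simp
    then show ?thesis
      using eventually_ge_at_top[of 1]
    proof eventually_elim
      case (elim N)
      then have "exp (real N * m) * W N (real N * m) < 1" by simp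
      then have "W N (real N * m) < exp (- real N * m)"
        by (simp add: exp_minus field_simps)
      then have "W N (real N * m) < W N (t N)"
        using level[of N] elim by simp
      then show ?case using antitone[of "real N * m" "t N" N] by linarith
    qed
  qed
  have above: "\<forall>\<^sub>F N in sequentially. real N * m - ln (real N) \<le> t N"
  proof -
    have "(\<lambda>N. sqrt (real N) * (exp (real N * m - ln (real N)) * W N (real N * m - ln (real N)))) \<longlonglongrightarrow> c"
      using tendsto_minus[OF ln_sqrt] by (intro tail) simp
    moreover have "filterlim (\<lambda>N. sqrt (real N)) at_top sequentially"
      by real_asymp
    ultimately have "filterlim (\<lambda>N. sqrt (real N) * (exp (real N * m - ln (real N)) * W N (real N * m - ln (real N)))
        * sqrt (real N)) at_top sequentially"
      using c by (intro filterlim_tendsto_pos_mult_at_top)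
    then have "\<forall>\<^sub>F N in sequentially. 1 < sqrt (real N) * (exp (real N * m - ln (real N)) * W N (real N * m - ln (real N)))
        * sqrt (real N)"
      by (simp add: filterlim_at_top_dense)
    then show ?thesis
      using eventually_ge_at_top[of 1]
    proof eventually_elim
      case (elim N)
      have "sqrt (real N) * (exp (real N * m - ln (real N)) * W N (real N * m - ln (real N))) * sqrt (real N)
          = exp (real N * m) * W N (real N * m - ln (real N))"
        using elim by (simp add: exp_diff field_simps)
      with elim have "1 < exp (real N * m) * W N (real N * m - ln (real N))" by simp
      then have "exp (- real N * m) < W N (real N * m - ln (real N))"
        by (simp add: exp_minus field_simps)
      then have "W N (t N) < W N (real N * m - ln (real N))"
        using level[of N] elim by simp
      then show ?case using antitone[of "t N" "real N * m - ln (real N)" N] by linarith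
    qed
  qed
  have t_lim: "(\<lambda>N. (t N - real N * m) / sqrt (real N)) \<longlonglongrightarrow> 0"
  proof (rule Lim_null_comparison[OF _ ln_sqrt])
    show "\<forall>\<^sub>F N in sequentially. norm ((t N - real N * m) / sqrt (real N)) \<le> ln (real N) / sqrt (real N)"
      using above below eventually_ge_at_top[of 1]
      by eventually_elim (simp add: divide_right_mono)
  qed
  have full: "(\<lambda>N. sqrt (real N) * (exp (t N) * W N (t N))) \<longlonglongrightarrow> c"
    by (rule tail[OF t_lim])
  \<comment> \<open>the number \<open>M = N - n\<close> of remaining summands becomes the running index\<close>
  have "(\<lambda>M. (t (M + n) - real (M + n) * m) / sqrt (real (M + n))) \<longlonglongrightarrow> 0"
    using t_lim by (rule LIMSEQ_ignore_initial_segment)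
  moreover have "(\<lambda>M. sqrt (real (M + n)) / sqrt (real M)) \<longlonglongrightarrow> 1"
    by real_asymp
  moreover have "(\<lambda>M. (real n * m - s) / sqrt (real M)) \<longlonglongrightarrow> 0"
    by real_asymp
  ultimately have "(\<lambda>M. (t (M + n) - real (M + n) * m) / sqrt (real (M + n)) * (sqrt (real (M + n)) / sqrt (real M))
      + (real n * m - s) / sqrt (real M)) \<longlonglongrightarrow> 0 * 1 + 0"
    by (intro tendsto_add tendsto_mult)
  moreover have "\<forall>\<^sub>F M in sequentially. (t (M + n) - real (M + n) * m) / sqrt (real (M + n)) * (sqrt (real (M + n)) / sqrt (real M))
      + (real n * m - s) / sqrt (real M) = (t (M + n) - s - real M * m) / sqrt (real M)"
    using eventually_gt_at_top[of 0] by eventually_elim (simp add: field_simps)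
  ultimately have "(\<lambda>M. (t (M + n) - s - real M * m) / sqrt (real M)) \<longlonglongrightarrow> 0 * 1 + 0"
    by (rule Lim_transform_eventually)
  then have "(\<lambda>M. (t (M + n) - s - real M * m) / sqrt (real M)) \<longlonglongrightarrow> 0"
    by (simp only: mult_zero_left add_0_right)
  then have rest: "(\<lambda>M. sqrt (real M) * (exp (t (M + n) - s) * W M (t (M + n) - s))) \<longlonglongrightarrow> c"
    by (rule tail)
  have "(\<lambda>M. sqrt (real (M + n)) * (exp (t (M + n)) * W (M + n) (t (M + n)))) \<longlonglongrightarrow> c"
    using full by (rule LIMSEQ_ignore_initial_segment)
  moreover have "(\<lambda>M. sqrt (real (M + n)) / sqrt (real M)) \<longlonglongrightarrow> 1"
    by real_asymp
  ultimately have "(\<lambda>M. exp s * (sqrt (real (M + n)) / sqrt (real M))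
      * (sqrt (real M) * (exp (t (M + n) - s) * W M (t (M + n) - s)))
      / (sqrt (real (M + n)) * (exp (t (M + n)) * W (M + n) (t (M + n))))) \<longlonglongrightarrow> exp s * 1 * c / c"
    using c rest by (intro tendsto_divide tendsto_mult tendsto_const) auto
  moreover have "\<forall>\<^sub>F M in sequentially. exp s * (sqrt (real (M + n)) / sqrt (real M))
      * (sqrt (real M) * (exp (t (M + n) - s) * W M (t (M + n) - s)))
      / (sqrt (real (M + n)) * (exp (t (M + n)) * W (M + n) (t (M + n))))
    = W M (t (M + n) - s) / exp (- real (M + n) * m)"
    using eventually_gt_at_top[of 0]
  proof eventually_elim
    case (elim M)
    then have "W (M + n) (t (M + n)) = exp (- real (M + n) * m)"
      by (intro level) simp
    then show ?case
      using elim by (simp only:) (simp add: exp_diff)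
  qed
  ultimately have "(\<lambda>M. W M (t (M + n) - s) / exp (- real (M + n) * m)) \<longlonglongrightarrow> exp s * 1 * c / c"
    by (rule Lim_transform_eventually)
  then show ?thesis
    using c by - (rule LIMSEQ_offset[where k = n], simp)
qed

section \<open>Conditional expectation given an independent block\<close>

lemma (in prob_space) sigma_finite_subalgebra_vimage_algebra:
  assumes "U \<in> measurable M S"
  shows "sigma_finite_subalgebra M (vimage_algebra (space M) U S)"
proof (rule finite_measure_subalgebra_is_sigma_finite, unfold_locales)
  show "subalgebra M (vimage_algebra (space M) U S)"
    unfolding subalgebra_def using measurable_space[OF assms]
    by (auto simp: sets_vimage_algebra2 intro!: measurable_sets[OF assms])
qed

text \<open>
  Freezing lemma: given \<open>U\<close>, an independent \<open>V\<close> is simply integrated out. Testing against a set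
  \<open>U -` C\<close> reduces this to Fubini for the product of the two laws.
\<close>
lemma (in prob_space) real_cond_exp_indep:
  fixes f :: "'b \<times> 'b \<Rightarrow> real"
  assumes ind: "indep_var S U T V"
    and f [measurable]: "f \<in> borel_measurable (S \<Otimes>\<^sub>M T)"
    and bound: "\<And>z. \<bar>f z\<bar> \<le> B"
  shows "AE \<omega> in M. real_cond_exp M (vimage_algebra (space M) U S) (\<lambda>\<omega>. f (U \<omega>, V \<omega>)) \<omega>
    = (LINT v|distr M T V. f (U \<omega>, v))"
proof -
  have U [measurable]: "random_variable S U" and V [measurable]: "random_variable T V"
    using ind by (auto dest: indep_var_rv1 indep_var_rv2)
  let ?F = "vimage_algebra (space M) U S"
  let ?g = "\<lambda>u. LINT v|distr M T V. f (u, v)"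
  interpret S: prob_space "distr M S U" by (rule prob_space_distr) measurable
  interpret T: prob_space "distr M T V" by (rule prob_space_distr) measurable
  interpret ST: pair_prob_space "distr M S U" "distr M T V" ..
  have f' [measurable]: "f \<in> borel_measurable (S \<Otimes>\<^sub>M distr M T V)"
    using f by (simp cong: measurable_cong_sets)
  have g [measurable]: "?g \<in> borel_measurable S"
    by (rule T.borel_measurable_lebesgue_integral) (simp add: f')
  have g_bound: "\<bar>?g u\<bar> \<le> B" if "u \<in> space S" for u
  proof -
    have "\<bar>?g u\<bar> \<le> (LINT v|distr M T V. \<bar>f (u, v)\<bar>)"
      by (rule integral_abs_bound)
    also have "\<dots> \<le> (LINT v|distr M T V. B)"
      using that bound by (intro integral_mono T.integrable_const T.integrable_const_bound[where B=B]) auto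
    finally show ?thesis using T.prob_space by simp
  qed
  interpret F: sigma_finite_subalgebra M ?F
    by (rule sigma_finite_subalgebra_vimage_algebra[OF U])
  show ?thesis
  proof (rule F.real_cond_exp_charact)
    show "integrable M (\<lambda>\<omega>. f (U \<omega>, V \<omega>))"
      using bound by (intro integrable_const_bound[where B=B]) auto
    show "integrable M (\<lambda>\<omega>. ?g (U \<omega>))"
      using g_bound measurable_space[OF U] by (intro integrable_const_bound[where B=B] AE_I2) auto
    show "(\<lambda>\<omega>. ?g (U \<omega>)) \<in> borel_measurable ?F"
      by (rule measurable_compose[OF _ g]) (rule measurable_vimage_algebra1, use U[THEN measurable_space] in auto)
    fix A assume "A \<in> sets ?F"
    then obtain C where A: "A = U -` C \<inter> space M" and C [measurable]: "C \<in> sets S"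
      using U[THEN measurable_space] by (auto simp: sets_vimage_algebra2)
    have int: "integrable (distr M S U \<Otimes>\<^sub>M distr M T V) (\<lambda>z. indicator C (fst z) * f z)"
    proof (rule ST.P.integrable_const_bound[where B=B])
      show "AE z in distr M S U \<Otimes>\<^sub>M distr M T V. norm (indicator C (fst z) * f z) \<le> B"
        using bound order_trans[OF abs_ge_zero bound]
        by (intro AE_I2) (auto simp: indicator_def)
    qed measurable
    have "set_lebesgue_integral M A (\<lambda>\<omega>. f (U \<omega>, V \<omega>)) = (LINT \<omega>|M. indicator C (fst (U \<omega>, V \<omega>)) * f (U \<omega>, V \<omega>))"
      unfolding set_lebesgue_integral_def
      by (intro Bochner_Integration.integral_cong) (auto simp: A indicator_def)
    also have "\<dots> = (LINT z|distr M (S \<Otimes>\<^sub>M T) (\<lambda>\<omega>. (U \<omega>, V \<omega>)). indicator C (fst z) * f z)"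
      by (rule integral_distr[symmetric]) measurable
    also have "\<dots> = (LINT z|(distr M S U \<Otimes>\<^sub>M distr M T V). indicator C (fst z) * f z)"
      using ind by (simp add: indep_var_distribution_eq)
    also have "\<dots> = (LINT u|distr M S U. LINT v|distr M T V. indicator C (fst (u, v)) * f (u, v))"
      by (rule ST.integral_fst'[OF int, symmetric])
    also have "\<dots> = (LINT u|distr M S U. indicator C u * ?g u)"
      by simp
    also have "\<dots> = (LINT \<omega>|M. indicator C (U \<omega>) * ?g (U \<omega>))"
      by (rule integral_distr) measurable
    also have "\<dots> = set_lebesgue_integral M A (\<lambda>\<omega>. ?g (U \<omega>))"
      unfolding set_lebesgue_integral_def
      by (intro Bochner_Integration.integral_cong) (auto simp: A indicator_def)
    finally show "set_lebesgue_integral M A (\<lambda>\<omega>. f (U \<omega>, V \<omega>)) = set_lebesgue_integral M A (\<lambda>\<omega>. ?g (U \<omega>))" .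
  qed
qed

lemma (in prob_space) distr_sum_iid:
  fixes Y :: "'i \<Rightarrow> 'a \<Rightarrow> real"
  assumes "finite I" "indep_vars (\<lambda>_. borel) Y I" "\<And>i. i \<in> I \<Longrightarrow> distr M borel (Y i) = \<nu>"
  shows "distr M borel (\<lambda>\<omega>. \<Sum>i\<in>I. Y i \<omega>) = conv_pow \<nu> (card I)"
  using assms
proof (induction I rule: finite_induct)
  case empty
  show ?case
    by (simp add: distr_const)
next
  case (insert i I)
  have meas: "random_variable borel (Y j)" if "j \<in> insert i I" for j
    using insert.prems(1) that by (auto simp: indep_vars_def)
  have "distr M borel (\<lambda>\<omega>. \<Sum>i\<in>insert i I. Y i \<omega>) = distr M borel (\<lambda>\<omega>. Y i \<omega> + (\<Sum>i\<in>I. Y i \<omega>))"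
    using insert.hyps by simp
  also have "\<dots> = (distr M borel (Y i) \<star> distr M borel (\<lambda>\<omega>. \<Sum>i\<in>I. Y i \<omega>))"
    using meas by (intro sum_indep_random_variable indep_vars_sum insert.hyps insert.prems borel_measurable_sum) auto
  also have "distr M borel (\<lambda>\<omega>. \<Sum>i\<in>I. Y i \<omega>) = conv_pow \<nu> (card I)"
    using insert.prems by (intro insert.IH indep_vars_subset[OF insert.prems(1)]) auto
  also have "(distr M borel (Y i) \<star> conv_pow \<nu> (card I)) = conv_pow \<nu> (card (insert i I))"
    using insert.hyps insert.prems(2)[of i] by simp
  finally show ?case .
qed

section \<open>The log-density ratio and the Neyman-Pearson test\<close>

lemma log_density_ratio_measurable [measurable]:
  "log_density_ratio P Q \<in> borel_measurable P"
  unfolding log_density_ratio_def[abs_def] by measurable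

context
  fixes P Q :: "'a measure"
  assumes P: "prob_space P" and Q: "prob_space Q" and sets_Q: "sets Q = sets P"
    and ac: "absolutely_continuous P Q" and ac': "absolutely_continuous Q P"
begin

text \<open>
  The logarithm of the density loses information exactly where the density is \<open>0\<close> or infinite. The
  first set is \<open>Q\<close>-null, hence \<open>P\<close>-null by mutual absolute continuity; the second is \<open>P\<close>-null.
\<close>
lemma AE_RN_deriv_eq_exp:
  "AE x in P. RN_deriv P Q x = ennreal (exp (log_density_ratio P Q x))"
proof -
  interpret P: prob_space P by (rule P)
  interpret Q: prob_space Q by (rule Q)
  have "AE x in density P (RN_deriv P Q). RN_deriv P Q x \<noteq> 0"
    by (subst AE_density) auto
  then have "AE x in Q. RN_deriv P Q x \<noteq> 0"
    by (simp only: P.density_RN_deriv[OF ac sets_Q])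
  then have "AE x in P. RN_deriv P Q x \<noteq> 0"
    by (rule absolutely_continuous_AE[OF sets_Q[symmetric] ac'])
  moreover have "AE x in P. RN_deriv P Q x \<noteq> \<infinity>"
    by (rule P.RN_deriv_finite[OF Q.sigma_finite_measure_axioms ac sets_Q])
  ultimately show ?thesis
  proof eventually_elim
    case (elim x)
    then have "0 < enn2real (RN_deriv P Q x)"
      by (simp add: enn2real_positive_iff top.not_eq_extremum zero_less_iff_neq_zero)
    with elim show ?case
      by (simp add: log_density_ratio_def top.not_eq_extremum)
  qed
qed

text \<open>
  The law of \<open>log dQ/dP\<close> under \<open>Q\<close> is its law under \<open>P\<close> tilted by \<open>exp\<close>.
\<close>
lemma tilted_log_density_ratio:
  "density (distr P borel (log_density_ratio P Q)) (\<lambda>x. ennreal (exp x))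
    = distr Q borel (log_density_ratio P Q)"
proof -
  interpret P: prob_space P by (rule P)
  have "density (distr P borel (log_density_ratio P Q)) (\<lambda>x. ennreal (exp x))
      = distr (density P (\<lambda>x. ennreal (exp (log_density_ratio P Q x)))) borel (log_density_ratio P Q)"
    by (rule density_distr) measurable
  also have "density P (\<lambda>x. ennreal (exp (log_density_ratio P Q x))) = density P (RN_deriv P Q)"
    using AE_RN_deriv_eq_exp by (intro density_cong) (auto elim!: eventually_mono)
  also have "\<dots> = Q"
    by (rule P.density_RN_deriv[OF ac sets_Q])
  finally show ?thesis .
qed

lemma log_density_ratio_measurable': "log_density_ratio P Q \<in> borel_measurable Q"
  using log_density_ratio_measurable[of P Q] by (simp cong: measurable_cong_sets add: sets_Q)

lemma KL_divergence_eq_mean: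
  "KL_divergence (exp 1) P Q = (LINT x|distr Q borel (log_density_ratio P Q). x)"
proof -
  have "(LINT x|distr Q borel (log_density_ratio P Q). x) = (LINT x|Q. log_density_ratio P Q x)"
    by (rule integral_distr[OF log_density_ratio_measurable']) simp
  then show ?thesis
    by (simp add: KL_divergence_def entropy_density_def log_density_ratio_def log_def comp_def)
qed

text \<open>
  Under \<open>Q\<close> the log-density ratio has two exponential moments: order \<open>\<epsilon>\<close> by the Renyi condition, and
  order \<open>-1\<close> because \<open>P\<close> is a probability measure. They bound \<open>y\<^sup>2\<close> on the positive and on the
  negative half-line, respectively.
\<close>
lemma square_integrable_log_density_ratio:
  assumes "\<epsilon> > 0" and renyi: "\<bar>renyi_divergence (1 + \<epsilon>) P Q\<bar> \<noteq> \<infinity>"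
  shows "integrable (distr Q borel (log_density_ratio P Q)) (\<lambda>x. x\<^sup>2)"
proof -
  interpret P: prob_space P by (rule P)
  define L where "L = log_density_ratio P Q"
  have [measurable]: "L \<in> borel_measurable P"
    unfolding L_def by measurable
  have "(\<integral>\<^sup>+x. ennreal (exp ((1 + \<epsilon>) * L x)) \<partial>P)
      = (\<integral>\<^sup>+x. ennreal (enn2real (RN_deriv P Q x) powr (1 + \<epsilon>)) \<partial>P)"
    using AE_RN_deriv_eq_exp
    by (intro nn_integral_cong_AE) (auto elim!: eventually_mono simp: powr_def L_def)
  also have "\<dots> < \<infinity>"
    using renyi by (auto simp: renyi_divergence_def Let_def top.not_eq_extremum[symmetric] split: if_splits)
  finally have moment: "integrable P (\<lambda>x. exp ((1 + \<epsilon>) * L x))"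
    by (intro integrableI_nonneg) auto
  have bound: "exp y * y\<^sup>2 \<le> 2 / \<epsilon>\<^sup>2 * exp ((1 + \<epsilon>) * y) + 2" for y :: real
  proof (cases "y \<ge> 0")
    case True
    have "(\<epsilon> * y)\<^sup>2 / 2 \<le> exp (\<epsilon> * y)"
      using exp_lower_Taylor_quadratic[of "\<epsilon> * y"] True assms(1)
        mult_nonneg_nonneg[of \<epsilon> y] by linarith
    then have "y\<^sup>2 \<le> 2 / \<epsilon>\<^sup>2 * exp (\<epsilon> * y)"
      using assms(1) by (simp add: power_mult_distrib field_simps)
    then have "exp y * y\<^sup>2 \<le> exp y * (2 / \<epsilon>\<^sup>2 * exp (\<epsilon> * y))"
      by (intro mult_left_mono) auto
    also have "\<dots> = 2 / \<epsilon>\<^sup>2 * exp ((1 + \<epsilon>) * y)"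
      by (simp add: distrib_right exp_add)
    finally show ?thesis by simp
  next
    case False
    have "(- y)\<^sup>2 / 2 \<le> exp (- y)"
      using exp_lower_Taylor_quadratic[of "- y"] False by linarith
    then have "exp y * y\<^sup>2 \<le> exp y * (2 * exp (- y))"
      by (intro mult_left_mono) auto
    also have "\<dots> = 2" by (simp add: exp_minus)
    finally show ?thesis
      using assms(1) by (smt (verit) divide_nonneg_nonneg exp_ge_zero mult_nonneg_nonneg zero_le_power2)
  qed
  have "integrable P (\<lambda>x. exp (L x) * (L x)\<^sup>2)"
  proof (rule Bochner_Integration.integrable_bound)
    show "integrable P (\<lambda>x. 2 / \<epsilon>\<^sup>2 * exp ((1 + \<epsilon>) * L x) + 2)"
      by (intro Bochner_Integration.integrable_add integrable_mult_right moment P.integrable_const)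
    show "AE x in P. norm (exp (L x) * (L x)\<^sup>2) \<le> norm (2 / \<epsilon>\<^sup>2 * exp ((1 + \<epsilon>) * L x) + 2)"
      using bound by (intro AE_I2) (smt (verit) exp_ge_zero mult_nonneg_nonneg real_norm_def zero_le_power2)
  qed measurable
  then have "integrable (distr P borel L) (\<lambda>x. exp x * x\<^sup>2)"
    by (subst integrable_distr_eq) simp_all
  then have "integrable (density (distr P borel L) (\<lambda>x. ennreal (exp x))) (\<lambda>x. x\<^sup>2)"
    by (subst integrable_density) simp_all
  then show ?thesis
    by (simp add: L_def tilted_log_density_ratio)
qed

end

text \<open>
  The test depends on the first \<open>n\<close> observations only through their log-likelihood ratio, and on the
  others through an independent sum with a known convolution power as law.
\<close>
lemma np_test_cond_exp:
  assumes \<Omega>: "prob_space \<Omega>" and iid: "iid \<Omega> P X" and n: "n \<le> N"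
    and log_LR: "AE \<omega> in \<Omega>. ln (LR P Q X N \<omega>) = (\<Sum>i<N. log_density_ratio P Q (X i \<omega>))"
  shows "AE \<omega> in \<Omega>. real_cond_exp \<Omega> (obs_algebra \<Omega> P X n) (np_test P Q X N t) \<omega>
    = measure (conv_pow (distr P borel (log_density_ratio P Q)) (N - n))
        {t - (\<Sum>i<n. log_density_ratio P Q (X i \<omega>))..}"
proof -
  interpret prob_space \<Omega> by (rule \<Omega>)
  define L where "L = log_density_ratio P Q"
  have [measurable]: "L \<in> borel_measurable P"
    unfolding L_def by measurable
  have indep: "indep_vars (\<lambda>_. P) X UNIV" and law: "distr \<Omega> P (X i) = P" for i
    using iid by (auto simp: iid_def)
  have X [measurable]: "X i \<in> measurable \<Omega> P" for i
    using indep by (auto simp: indep_vars_def)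
  define U where "U \<omega> = (\<lambda>i\<in>{..<n}. X i \<omega>)" for \<omega>
  define V where "V \<omega> = (\<lambda>i\<in>{n..<N}. X i \<omega>)" for \<omega>
  let ?S = "Pi\<^sub>M {..<n} (\<lambda>_. P)" and ?T = "Pi\<^sub>M {n..<N} (\<lambda>_. P)"
  have ind: "indep_var ?S U ?T V"
    unfolding U_def V_def by (intro indep_var_restrict[OF indep]) auto
  have U [measurable]: "U \<in> measurable \<Omega> ?S" and V [measurable]: "V \<in> measurable \<Omega> ?T"
    using ind by (auto dest: indep_var_rv1 indep_var_rv2)
  define f where "f z = (if t \<le> (\<Sum>i<n. L (fst z i)) + (\<Sum>i\<in>{n..<N}. L (snd z i)) then 1 else 0 :: real)" for z
  have f [measurable]: "f \<in> borel_measurable (?S \<Otimes>\<^sub>M ?T)"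
    unfolding f_def[abs_def] by measurable
  interpret F: sigma_finite_subalgebra \<Omega> "vimage_algebra (space \<Omega>) U ?S"
    by (rule sigma_finite_subalgebra_vimage_algebra[OF U])
  have split: "(\<Sum>i<n. L (X i \<omega>)) + (\<Sum>i\<in>{n..<N}. L (X i \<omega>)) = (\<Sum>i<N. L (X i \<omega>))" for \<omega>
    using sum.atLeastLessThan_concat[of 0 n N "\<lambda>i. L (X i \<omega>)"] n by (simp add: lessThan_atLeast0)
  have f_UV: "f (U \<omega>, V \<omega>) = (if t \<le> (\<Sum>i<N. L (X i \<omega>)) then 1 else 0)" for \<omega>
    using split[of \<omega>] by (simp add: f_def U_def V_def)
  have "AE \<omega> in \<Omega>. real_cond_exp \<Omega> (vimage_algebra (space \<Omega>) U ?S) (np_test P Q X N t) \<omega>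
      = real_cond_exp \<Omega> (vimage_algebra (space \<Omega>) U ?S) (\<lambda>\<omega>. f (U \<omega>, V \<omega>)) \<omega>"
  proof (rule F.real_cond_exp_cong)
    show "AE \<omega> in \<Omega>. np_test P Q X N t \<omega> = f (U \<omega>, V \<omega>)"
      using log_LR by eventually_elim (simp add: np_test_def f_UV L_def)
    show "np_test P Q X N t \<in> borel_measurable \<Omega>"
      unfolding np_test_def[abs_def] LR_def[abs_def] by measurable
  qed measurable
  moreover have "AE \<omega> in \<Omega>. real_cond_exp \<Omega> (vimage_algebra (space \<Omega>) U ?S) (\<lambda>\<omega>. f (U \<omega>, V \<omega>)) \<omega>
      = (LINT v|distr \<Omega> ?T V. f (U \<omega>, v))"
    by (rule real_cond_exp_indep[OF ind f, where B=1]) (simp add: f_def)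
  moreover have "(LINT v|distr \<Omega> ?T V. f (U \<omega>, v))
      = measure (conv_pow (distr P borel L) (N - n)) {t - (\<Sum>i<n. L (X i \<omega>))..}" if "\<omega> \<in> space \<Omega>" for \<omega>
  proof -
    let ?R = "\<lambda>\<omega>'. \<Sum>i\<in>{n..<N}. L (X i \<omega>')"
    have U\<omega>: "U \<omega> \<in> space ?S"
      using measurable_space[OF U that] .
    have f_U [measurable]: "(\<lambda>v. f (U \<omega>, v)) \<in> borel_measurable ?T"
      by (rule measurable_compose[OF measurable_Pair1'[OF U\<omega>] f])
    have "(LINT v|distr \<Omega> ?T V. f (U \<omega>, v)) = (LINT \<omega>'|\<Omega>. f (U \<omega>, V \<omega>'))"
      by (rule integral_distr) measurable
    also have "\<dots> = (LINT \<omega>'|\<Omega>. indicator {t - (\<Sum>i<n. L (X i \<omega>))..} (?R \<omega>'))"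
      by (intro Bochner_Integration.integral_cong) (auto simp: f_def U_def V_def indicator_def)
    also have "\<dots> = (LINT x|distr \<Omega> borel ?R. indicator {t - (\<Sum>i<n. L (X i \<omega>))..} x)"
      by (rule integral_distr[symmetric]) measurable
    also have "\<dots> = measure (distr \<Omega> borel ?R) {t - (\<Sum>i<n. L (X i \<omega>))..}"
      by simp
    also have "distr \<Omega> borel ?R = conv_pow (distr P borel L) (card {n..<N})"
    proof (rule distr_sum_iid)
      show "indep_vars (\<lambda>_. borel) (\<lambda>i \<omega>'. L (X i \<omega>')) {n..<N}"
        by (rule indep_vars_compose2[OF indep_vars_subset[OF indep]]) auto
      show "distr \<Omega> borel (\<lambda>\<omega>'. L (X i \<omega>')) = distr P borel L" for i
        using distr_distr[of L P borel "X i" \<Omega>] by (simp add: law comp_def)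
    qed simp
    finally show ?thesis by simp
  qed
  ultimately have "AE \<omega> in \<Omega>. real_cond_exp \<Omega> (vimage_algebra (space \<Omega>) U ?S) (np_test P Q X N t) \<omega>
      = measure (conv_pow (distr P borel L) (N - n)) {t - (\<Sum>i<n. L (X i \<omega>))..}"
    by (auto elim!: AE_mp)
  then show ?thesis
    by (simp add: obs_algebra_def U_def[abs_def] L_def)
qed

theorem theorem8:
  fixes P Q :: "'a measure" and \<Omega> :: "'w measure"
    and X :: "nat \<Rightarrow> 'w \<Rightarrow> 'a" and \<alpha> t :: "nat \<Rightarrow> real"
  assumes "prob_space P" and "prob_space Q" and "sets Q = sets P"
    and "absolutely_continuous P Q" and "absolutely_continuous Q P"
    and "atomless (distr P borel (log_density_ratio P Q))"
    and "prob_space \<Omega>" and "iid \<Omega> P X"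
    and "\<And>N. \<alpha> N = exp (- real N * KL_divergence (exp 1) P Q)"
    and "\<And>N. N \<ge> 1 \<Longrightarrow> np_threshold \<Omega> P Q X N (\<alpha> N) (t N)"
    and "\<exists>\<epsilon>>0. \<bar>renyi_divergence (1 + \<epsilon>) P Q\<bar> \<noteq> \<infinity>"
    and "\<not> lattice_valued \<Omega> (\<lambda>\<omega>. ln (LR P Q X 1 \<omega>))"
  shows "\<forall>n. AE \<omega> in \<Omega>.
           (\<lambda>N. real_cond_exp \<Omega> (obs_algebra \<Omega> P X n) (np_test P Q X N (t N)) \<omega> / \<alpha> N)
             \<longlonglongrightarrow> LR P Q X n \<omega>"
proof
  fix n
  note PQ = assms(1-5)
  interpret P: prob_space P by (rule assms(1))
  interpret Q: prob_space Q by (rule assms(2))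
  interpret \<Omega>: prob_space \<Omega> by (rule assms(7))
  define L where "L = log_density_ratio P Q"
  have L [measurable]: "L \<in> borel_measurable P"
    unfolding L_def by measurable
  have LQ: "L \<in> borel_measurable Q"
    unfolding L_def by (rule log_density_ratio_measurable'[OF PQ])
  have indep: "\<Omega>.indep_vars (\<lambda>_. P) X UNIV" and law: "distr \<Omega> P (X i) = P" for i
    using assms(8) by (auto simp: iid_def)
  have X [measurable]: "X i \<in> measurable \<Omega> P" for i
    using indep by (auto simp: \<Omega>.indep_vars_def)
  define \<nu> where "\<nu> = distr P borel L"
  define \<mu> where "\<mu> = density \<nu> (\<lambda>x. ennreal (exp x))"
  define m where "m = KL_divergence (exp 1) P Q"
  have \<nu>: "real_distribution \<nu>"
    unfolding \<nu>_def by (rule P.real_distribution_distr[OF L])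
  have \<mu>_eq: "\<mu> = distr Q borel L"
    unfolding \<mu>_def \<nu>_def L_def by (rule tilted_log_density_ratio[OF PQ])
  interpret \<mu>: real_distribution \<mu>
    unfolding \<mu>_eq by (rule Q.real_distribution_distr[OF LQ])
  obtain \<epsilon> where \<epsilon>: "\<epsilon> > 0" "\<bar>renyi_divergence (1 + \<epsilon>) P Q\<bar> \<noteq> \<infinity>"
    using assms(11) by (elim exE conjE)
  have sq: "integrable \<mu> (\<lambda>x. x\<^sup>2)"
    unfolding \<mu>_eq L_def by (rule square_integrable_log_density_ratio[OF PQ \<epsilon>])
  have int: "integrable \<mu> (\<lambda>x. x)"
    by (rule \<mu>.square_integrable_imp_integrable[OF _ sq]) simp
  have mean: "(LINT x|\<mu>. x) = m"
    unfolding \<mu>_eq m_def L_def by (rule KL_divergence_eq_mean[OF PQ, symmetric])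
  have nonlattice: "\<forall>a h. h > 0 \<longrightarrow> \<not> (AE x in \<mu>. x \<in> {a + of_int k * h | k :: int. True})"
  proof (intro allI impI notI)
    fix a h :: real assume h: "h > 0"
    assume "AE x in \<mu>. x \<in> {a + of_int k * h | k :: int. True}"
    then have "AE x in Q. L x \<in> {a + of_int k * h | k :: int. True}"
      unfolding \<mu>_eq by (rule AE_distrD[OF LQ])
    then have "AE x in P. L x \<in> {a + of_int k * h | k :: int. True}"
      by (rule absolutely_continuous_AE[OF assms(3)[symmetric] assms(5)])
    then have "AE \<omega> in \<Omega>. L (X 0 \<omega>) \<in> {a + of_int k * h | k :: int. True}"
      by (intro AE_distrD[OF X[of 0]]) (simp only: law)
    then have "lattice_valued \<Omega> (\<lambda>\<omega>. ln (LR P Q X 1 \<omega>))"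
      unfolding lattice_valued_def LR_def
      by (intro exI[of _ a] exI[of _ h] conjI h) (simp add: L_def log_density_ratio_def)
    with assms(12) show False by blast
  qed

  have "AE x in P. enn2real (RN_deriv P Q x) = exp (L x)"
    using AE_RN_deriv_eq_exp[OF PQ] by eventually_elim (simp add: L_def)
  then have "AE \<omega> in \<Omega>. enn2real (RN_deriv P Q (X i \<omega>)) = exp (L (X i \<omega>))" for i
    by (intro AE_distrD[OF X[of i]]) (simp only: law)
  then have "AE \<omega> in \<Omega>. \<forall>i. enn2real (RN_deriv P Q (X i \<omega>)) = exp (L (X i \<omega>))"
    by (simp add: AE_all_countable)
  then have LR_eq: "AE \<omega> in \<Omega>. \<forall>N. LR P Q X N \<omega> = exp (\<Sum>i<N. L (X i \<omega>))"
    by eventually_elim (simp add: LR_def exp_sum)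
  then have log_LR: "AE \<omega> in \<Omega>. ln (LR P Q X N \<omega>) = (\<Sum>i<N. log_density_ratio P Q (X i \<omega>))" for N
    by eventually_elim (simp add: L_def)

  define W where "W N s = measure (conv_pow \<nu> N) {s..}" for N s
  have antitone: "W N y \<le> W N x" if "x \<le> y" for N x y
  proof -
    interpret N: real_distribution "conv_pow \<nu> N" by (rule real_distribution_conv_pow[OF \<nu>])
    show ?thesis
      unfolding W_def using that by (intro N.finite_measure_mono) auto
  qed
  have level: "W N (t N) = exp (- real N * m)" if "N \<ge> 1" for N
  proof -
    let ?S = "\<lambda>\<omega>. \<Sum>i\<in>{..<N}. L (X i \<omega>)"
    have "distr \<Omega> borel ?S = conv_pow \<nu> (card {..<N})"
      unfolding \<nu>_def
    proof (rule \<Omega>.distr_sum_iid)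
      show "\<Omega>.indep_vars (\<lambda>_. borel) (\<lambda>i \<omega>'. L (X i \<omega>')) {..<N}"
        by (rule \<Omega>.indep_vars_compose2[OF \<Omega>.indep_vars_subset[OF indep]]) auto
      show "distr \<Omega> borel (\<lambda>\<omega>'. L (X i \<omega>')) = distr P borel L" for i
        using distr_distr[of L P borel "X i" \<Omega>] by (simp add: law comp_def)
    qed simp
    then have "W N (t N) = measure (distr \<Omega> borel ?S) {t N..}"
      by (simp add: W_def)
    also have "\<dots> = measure \<Omega> {\<omega> \<in> space \<Omega>. t N \<le> ?S \<omega>}"
      by (subst measure_distr) (auto intro!: arg_cong[where f="measure \<Omega>"])
    also have "\<dots> = measure \<Omega> {\<omega> \<in> space \<Omega>. t N \<le> ln (LR P Q X N \<omega>)}"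
    proof (rule measure_eq_AE)
      show "AE \<omega> in \<Omega>. (\<omega> \<in> {\<omega> \<in> space \<Omega>. t N \<le> ?S \<omega>})
          = (\<omega> \<in> {\<omega> \<in> space \<Omega>. t N \<le> ln (LR P Q X N \<omega>)})"
        using log_LR[of N] by eventually_elim (simp add: L_def)
      show "{\<omega> \<in> space \<Omega>. t N \<le> ln (LR P Q X N \<omega>)} \<in> sets \<Omega>"
        unfolding LR_def by measurable
    qed measurable
    also have "\<dots> = exp (- real N * m)"
      using assms(10)[OF that] by (simp add: np_threshold_def assms(9) m_def)
    finally show ?thesis .
  qed
  obtain c where "c > 0" and tail: "\<forall>T. (\<lambda>N. (T N - real N * m) / sqrt (real N)) \<longlonglongrightarrow> 0 \<longrightarrow>
      (\<lambda>N. sqrt (real N) * (exp (T N) * W N (T N))) \<longlonglongrightarrow> c"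
    unfolding W_def
    using exact_tail_asymptotics[OF \<nu>, folded \<mu>_def, OF \<mu>.real_distribution_axioms int mean sq nonlattice]
    by (elim exE conjE)
  have ratio: "(\<lambda>N. W (N - n) (t N - s) / exp (- real N * m)) \<longlonglongrightarrow> exp s" for s
    by (rule tail_ratio_tendsto[OF antitone \<open>c > 0\<close> tail[rule_format] level])

  have "AE \<omega> in \<Omega>. real_cond_exp \<Omega> (obs_algebra \<Omega> P X n) (np_test P Q X N (t N)) \<omega>
      = W (N - n) (t N - (\<Sum>i<n. L (X i \<omega>)))" if "n \<le> N" for N
    unfolding W_def \<nu>_def L_def
    by (rule np_test_cond_exp[OF assms(7,8) that log_LR])
  then have "AE \<omega> in \<Omega>. \<forall>N. n \<le> N \<longrightarrow> real_cond_exp \<Omega> (obs_algebra \<Omega> P X n) (np_test P Q X N (t N)) \<omega>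
      = W (N - n) (t N - (\<Sum>i<n. L (X i \<omega>)))"
    by (simp add: AE_all_countable)
  with LR_eq show "AE \<omega> in \<Omega>.
      (\<lambda>N. real_cond_exp \<Omega> (obs_algebra \<Omega> P X n) (np_test P Q X N (t N)) \<omega> / \<alpha> N) \<longlonglongrightarrow> LR P Q X n \<omega>"
  proof eventually_elim
    case (elim \<omega>)
    have "\<forall>\<^sub>F N in sequentially. W (N - n) (t N - (\<Sum>i<n. L (X i \<omega>))) / exp (- real N * m)
        = real_cond_exp \<Omega> (obs_algebra \<Omega> P X n) (np_test P Q X N (t N)) \<omega> / \<alpha> N"
      using eventually_ge_at_top[of n] by eventually_elim (use elim in \<open>simp add: assms(9) m_def\<close>)
    from Lim_transform_eventually[OF ratio this] show ?case
      using elim(1) by simp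
  qed
qed

end
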